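(* Let $n\ge2$, let $\varphi:\mathbb{R}^{n-1}\to\mathbb{R}$ be a smooth function which is coercive, i.e. $$\lim_{|x'|\to\infty}\varphi(x')=+\infty,$$ let $\Omega=\{(x',x_n)\in\mathbb{R}^n: x_n>\varphi(x')\}$, and let $W$ be a double well potential satisfying (W1)–(W5) (listed in the context). Then there is no solution $u$ to the overdetermined problem $$\Delta u=W'(u),\quad u>0\ \text{ in }\Omega,\qquad u=0\ \text{ on }\partial\Omega,\qquad \frac{\partial u}{\partial\nu}=\text{const. on }\partial\Omega,$$ whatever the value of the constant.
   Context: Here $\nu$ is the outer unit normal to $\partial\Omega$; a solution is a classical one, $u\in C^2(\Omega)\cap C^1(\overline\Omega)$. Assumptions on $W\in C^2([0,+\infty))$: (W1) $W\ge 0$, $W(1)=0$ and $W>0$ in $[0,1)$; (W2) for some $\gamma\in(0,1)$, $W'<0$ on $(\gamma,1)$; (W3) there is a constant $\kappa>0$ with $W''(s)\ge\kappa$ for all $s\ge\gamma$; (W4) there are constants $p>1$ and $c>0$ with $W'(s)\ge c(s-1)^p$ for $s>1$; (W5) $W'<0$ in $(0,1)$, and either $W'(0)\ne0$, or $W'(0)=0$ and $W''(0)\neq0$. *)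

theory Defs
  imports "HOL-Analysis.Analysis"
begin

(* Meant for open S in finite dimension: all iterated directional derivatives up to order k
   exist (as total derivatives, below order k) and are continuous on S. *)
primrec Ck_on :: "nat \<Rightarrow> 'a::euclidean_space set \<Rightarrow> ('a \<Rightarrow> real) \<Rightarrow> bool" where
  "Ck_on 0 S f \<longleftrightarrow> continuous_on S f"
| "Ck_on (Suc k) S f \<longleftrightarrow> (\<forall>x\<in>S. f differentiable (at x)) \<and>
     (\<forall>v. Ck_on k S (\<lambda>x. frechet_derivative f (at x) v))"

definition smooth_on :: "'a::euclidean_space set \<Rightarrow> ('a \<Rightarrow> real) \<Rightarrow> bool" where
  "smooth_on S f \<longleftrightarrow> (\<forall>k. Ck_on k S f)"

definition coercive :: "('a::real_normed_vector \<Rightarrow> real) \<Rightarrow> bool" where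
  "coercive f \<longleftrightarrow> filterlim f at_top at_infinity"

definition epigraph_domain :: "('a \<Rightarrow> real) \<Rightarrow> ('a \<times> real) set" where
  "epigraph_domain \<phi> = {(x', t). t > \<phi> x'}"

definition laplacian :: "('a::euclidean_space \<Rightarrow> real) \<Rightarrow> 'a \<Rightarrow> real" where
  "laplacian u x =
     (\<Sum>i\<in>Basis. frechet_derivative (\<lambda>y. frechet_derivative u (at y) i) (at x) i)"

(* u is of class C^1 up to the boundary, and G is the continuous extension of its gradient
   to the closure of \<Omega>; on the boundary, G x \<bullet> \<nu> is the normal derivative of u.
   For open \<Omega>, G is unique on the closure. *)
definition C1_closure_grad ::
    "'a::euclidean_space set \<Rightarrow> ('a \<Rightarrow> real) \<Rightarrow> ('a \<Rightarrow> 'a) \<Rightarrow> bool" where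
  "C1_closure_grad \<Omega> u G \<longleftrightarrow>
     continuous_on (closure \<Omega>) u \<and> continuous_on (closure \<Omega>) G \<and>
     (\<forall>x\<in>\<Omega>. GDERIV u x :> G x)"

(* Near x, \<Omega> is the sublevel set {\<rho> < 0} of a C^1 local defining function \<rho> with nonzero
   gradient at x; the outer unit normal is the normalised gradient of \<rho>. *)
definition outer_unit_normal :: "'a::euclidean_space set \<Rightarrow> 'a \<Rightarrow> 'a \<Rightarrow> bool" where
  "outer_unit_normal \<Omega> x \<nu> \<longleftrightarrow> x \<in> frontier \<Omega> \<and>
     (\<exists>U \<rho> g. open U \<and> x \<in> U \<and> Ck_on 1 U \<rho> \<and> \<Omega> \<inter> U = {y \<in> U. \<rho> y < 0} \<and>
        GDERIV \<rho> x :> g \<and> g \<noteq> 0 \<and> \<nu> = g /\<^sub>R norm g)"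

definition overdetermined_solution ::
    "'a::euclidean_space set \<Rightarrow> (real \<Rightarrow> real) \<Rightarrow> real \<Rightarrow> ('a \<Rightarrow> real) \<Rightarrow> bool" where
  "overdetermined_solution \<Omega> f c u \<longleftrightarrow>
     Ck_on 2 \<Omega> u \<and>
     (\<forall>x\<in>\<Omega>. laplacian u x = f (u x) \<and> u x > 0) \<and>
     (\<forall>x\<in>frontier \<Omega>. u x = 0) \<and>
     (\<exists>G. C1_closure_grad \<Omega> u G \<and>
        (\<forall>x\<in>frontier \<Omega>. \<forall>\<nu>. outer_unit_normal \<Omega> x \<nu> \<longrightarrow> G x \<bullet> \<nu> = c))"

(* W is C^2 on [0,\<infinity>) with first and second derivatives W' and W''
   (one-sided derivatives at 0). *)
definition C2_half_line ::
    "(real \<Rightarrow> real) \<Rightarrow> (real \<Rightarrow> real) \<Rightarrow> (real \<Rightarrow> real) \<Rightarrow> bool" where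
  "C2_half_line W W' W'' \<longleftrightarrow>
     (\<forall>s\<ge>0. (W has_real_derivative W' s) (at s within {0..})) \<and>
     (\<forall>s\<ge>0. (W' has_real_derivative W'' s) (at s within {0..})) \<and>
     continuous_on {0..} W''"

(* The monotonicity of W below 1 and the convexity bound on W'' refer to the same \<gamma>.
   On the half line W' stands for the derivative of W, as in C2_half_line. *)
definition double_well ::
    "(real \<Rightarrow> real) \<Rightarrow> (real \<Rightarrow> real) \<Rightarrow> (real \<Rightarrow> real) \<Rightarrow> bool" where
  "double_well W W' W'' \<longleftrightarrow>
     ((\<forall>s\<ge>0. W s \<ge> 0) \<and> W 1 = 0 \<and> (\<forall>s\<in>{0..<1}. W s > 0)) \<and>
     (\<exists>\<gamma>\<in>{0<..<1}. (\<forall>s\<in>{\<gamma><..<1}. W' s < 0) \<and>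
        (\<exists>\<kappa>>0. \<forall>s\<ge>\<gamma>. W'' s \<ge> \<kappa>)) \<and>
     (\<exists>p>1. \<exists>c>0. \<forall>s>1. W' s \<ge> c * (s - 1) powr p) \<and>
     ((\<forall>s\<in>{0<..<1}. W' s < 0) \<and> (W' 0 \<noteq> 0 \<or> (W' 0 = 0 \<and> W'' 0 \<noteq> 0)))"

end

theory Submission
  imports Defs
begin

text \<open>
  Let \<open>z\<close> be a minimum point of \<open>\<phi>\<close>, so that \<open>\<Omega>\<close> lies in the half space \<open>x\<^sub>n > \<phi> z\<close> and
  touches its boundary above \<open>z\<close>.  A Keller-Osserman barrier gives \<open>u \<le> 1\<close>.  Comparing \<open>u\<close> with the
  one-dimensional solution \<open>g\<close> of \<open>g'' = W'(g)\<close> on the half space, whose slope at \<open>0\<close> is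
  \<open>sqrt (2 W(0))\<close>, shows that the slope of \<open>u\<close> above \<open>z\<close> is strictly smaller than \<open>sqrt (2 W(0))\<close>.
  Since \<open>\<phi>\<close> is coercive, the part of \<open>\<Omega>\<close> below any given height is bounded, which supplies the
  compactness.  On the other hand \<open>\<Omega>\<close> contains balls of every radius \<open>R\<close> touching its boundary, and
  comparison with a radial subsolution in such a ball shows that the slope at the contact point is at
  least \<open>sqrt (2 W(0)) - o(1)\<close> as \<open>R \<rightarrow> \<infinity>\<close>.  Both slopes equal \<open>-c\<close>.

  No ordinary differential equation has to be solved: instead of \<open>u\<close> and \<open>g(\<zeta>)\<close> one compares
  \<open>T(u)\<close> and \<open>\<zeta>\<close>, where \<open>T' = 1 / sqrt (2 \<Phi>)\<close> and \<open>\<Phi>\<close> is a perturbation of \<open>W\<close>.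
\<close>

section \<open>Second derivatives along coordinate lines\<close>

text \<open>The strict upper bound must use something that a half space lacks, since there
  \<open>g\<close> of the height is an exact solution of slope \<open>sqrt (2 W(0))\<close>. What is
  special here is that the part of \<Omega> below a given height is bounded. Hence exp (k (x . d)),
  with d a horizontal unit vector, is bounded there, and the height t can be lowered to t -
  \<epsilon> exp (k (x . d)) s(t) without becoming negative on the boundary. The exponential factor
  is essential: a correction depending on t alone would have to be convex and yet positive between
  two zeros. So a horizontal direction is needed, that is n >= 2; on a half line \<open>g\<close>
  itself is a solution.

  With \<Phi> = W the contact inequality between T(u) and the height is only 0 <= 0, and T blows up
  at 1 because W vanishes there to second order. Perturbing \<Phi> produces a strict sign: in the
  upper comparison it also keeps \<Phi> positive up to 1, in the lower one it must keep the
  quadratic vanishing at 1. The perturbation of the upper comparison is finally sent to 0, so the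
  gain in slope has to be independent of it.\<close>

definition second_partials ::
    "('a::euclidean_space \<Rightarrow> real) \<Rightarrow> 'a \<Rightarrow> ('a \<Rightarrow> real) \<Rightarrow> ('a \<Rightarrow> real) \<Rightarrow> bool" where
  "second_partials f x a b \<longleftrightarrow>
     (\<forall>i\<in>Basis. \<exists>Z. (\<forall>\<^sub>F t in nhds 0. ((\<lambda>t. f (x + t *\<^sub>R i)) has_real_derivative Z t) (at t)) \<and>
        Z 0 = a i \<and> (Z has_real_derivative b i) (at 0))"

lemma second_derivative_local_max:
  fixes f f' :: "real \<Rightarrow> real"
  assumes f: "\<forall>\<^sub>F t in nhds 0. (f has_real_derivative f' t) (at t)"
    and f': "(f' has_real_derivative D) (at 0)"
    and max: "\<forall>\<^sub>F t in nhds 0. f t \<le> f 0"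
  shows "f' 0 = 0" and "D \<le> 0"
proof -
  from eventually_conj[OF f max] obtain e where e: "e > 0"
    "\<And>t. dist t 0 < e \<Longrightarrow> (f has_real_derivative f' t) (at t) \<and> f t \<le> f 0"
    unfolding eventually_nhds_metric by blast
  show z: "f' 0 = 0"
    by (rule DERIV_local_max[of f _ 0 e]) (use e in \<open>auto simp: dist_real_def abs_minus_commute\<close>)
  show "D \<le> 0"
  proof (rule ccontr)
    assume "\<not> D \<le> 0"
    then obtain d where d: "d > 0" "\<And>h. h > 0 \<Longrightarrow> h < d \<Longrightarrow> f' 0 < f' (0 + h)"
      using DERIV_pos_inc_right[OF f'] by auto
    define h where "h = min d e / 2"
    have h: "0 < h" "h < d" "h < e" using d(1) e(1) by (auto simp: h_def)
    obtain z where "0 < z" "z < h" "f h - f 0 = (h - 0) * f' z"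
      using MVT2[of 0 h f f'] e(2) h by (auto simp: dist_real_def)
    moreover have "f' z > 0" using d(2)[of z] z \<open>0 < z\<close> \<open>z < h\<close> h by auto
    ultimately have "f h > f 0" using h by (simp add: algebra_simps)
    with e(2)[of h] h show False by (auto simp: dist_real_def)
  qed
qed

lemma line_tendsto_nhds:
  fixes x i :: "'a::real_normed_vector"
  shows "filterlim (\<lambda>t. x + t *\<^sub>R i) (nhds x) (nhds 0)"
proof -
  have "isCont (\<lambda>t. x + t *\<^sub>R i) 0" by (intro continuous_intros)
  then show ?thesis
    using tendsto_at_iff_tendsto_nhds[of "\<lambda>t. x + t *\<^sub>R i" 0] by (simp add: continuous_within)
qed

text \<open>The Laplacian and the test at a maximum involve only pure second derivatives along the
  basis directions. This is why \<open>second_partials\<close> asks for a first derivative near the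
  point along each coordinate line and for its derivative at the point, and for no total second
  derivative. The notion is stable under sums, products and composition with a real
  function.\<close>

lemma second_partials_local_max:
  assumes "second_partials f x a b" and "\<forall>\<^sub>F y in nhds x. f y \<le> f x"
  shows "\<And>i. i \<in> Basis \<Longrightarrow> a i = 0" and "(\<Sum>i\<in>Basis. b i) \<le> 0"
proof -
  have "a i = 0 \<and> b i \<le> 0" if i: "i \<in> Basis" for i
  proof -
    obtain Z where Z: "\<forall>\<^sub>F t in nhds 0. ((\<lambda>t. f (x + t *\<^sub>R i)) has_real_derivative Z t) (at t)"
      "Z 0 = a i" "(Z has_real_derivative b i) (at 0)"
      using assms(1) i unfolding second_partials_def by blast
    have "\<forall>\<^sub>F t in nhds 0. f (x + t *\<^sub>R i) \<le> f (x + 0 *\<^sub>R i)"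
      using eventually_compose_filterlim[OF assms(2) line_tendsto_nhds[of x i]] by simp
    from second_derivative_local_max[OF Z(1,3) this] Z(2) show ?thesis by simp
  qed
  then show "\<And>i. i \<in> Basis \<Longrightarrow> a i = 0" "(\<Sum>i\<in>Basis. b i) \<le> 0" by (auto intro: sum_nonpos)
qed

lemma second_partials_inner: "second_partials (\<lambda>y. y \<bullet> v) x (\<lambda>i. i \<bullet> v) (\<lambda>i. 0)"
  unfolding second_partials_def
proof
  fix i :: 'a
  show "\<exists>Z. (\<forall>\<^sub>F t in nhds 0. ((\<lambda>t. (x + t *\<^sub>R i) \<bullet> v) has_real_derivative Z t) (at t)) \<and>
        Z 0 = i \<bullet> v \<and> (Z has_real_derivative 0) (at 0)"
    by (rule exI[of _ "\<lambda>_. i \<bullet> v"])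
       (auto simp: inner_add_left intro!: always_eventually derivative_eq_intros)
qed

lemma second_partials_norm_square:
  "second_partials (\<lambda>y. (norm (y - p))\<^sup>2) x (\<lambda>i. 2 * ((x - p) \<bullet> i)) (\<lambda>i. 2)"
  unfolding second_partials_def
proof
  fix i :: 'a assume i: "i \<in> Basis"
  have eq: "(\<lambda>t. (norm (x + t *\<^sub>R i - p))\<^sup>2) = (\<lambda>t. (norm (x - p))\<^sup>2 + 2 * t * ((x - p) \<bullet> i) + t\<^sup>2)"
  proof
    fix t
    have "(norm ((x - p) + t *\<^sub>R i))\<^sup>2 = (norm (x - p))\<^sup>2 + 2 * t * ((x - p) \<bullet> i) + t\<^sup>2"
      using i unfolding power2_norm_eq_inner inner_add_left inner_add_right
      by (simp add: inner_commute power2_eq_square)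
    then show "(norm (x + t *\<^sub>R i - p))\<^sup>2 = (norm (x - p))\<^sup>2 + 2 * t * ((x - p) \<bullet> i) + t\<^sup>2"
      by (simp add: algebra_simps)
  qed
  show "\<exists>Z. (\<forall>\<^sub>F t in nhds 0. ((\<lambda>t. (norm (x + t *\<^sub>R i - p))\<^sup>2) has_real_derivative Z t) (at t)) \<and>
        Z 0 = 2 * ((x - p) \<bullet> i) \<and> (Z has_real_derivative 2) (at 0)"
    unfolding eq
    by (rule exI[of _ "\<lambda>t. 2 * ((x - p) \<bullet> i) + 2 * t"])
       (auto intro!: always_eventually derivative_eq_intros)
qed

lemma second_partials_add:
  assumes "second_partials f x a b" "second_partials g x a' b'"
  shows "second_partials (\<lambda>y. f y + g y) x (\<lambda>i. a i + a' i) (\<lambda>i. b i + b' i)"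
  unfolding second_partials_def
proof
  fix i :: 'a assume i: "i \<in> Basis"
  obtain Z Y where "\<forall>\<^sub>F t in nhds 0. ((\<lambda>t. f (x + t *\<^sub>R i)) has_real_derivative Z t) (at t)"
      "Z 0 = a i" "(Z has_real_derivative b i) (at 0)"
      "\<forall>\<^sub>F t in nhds 0. ((\<lambda>t. g (x + t *\<^sub>R i)) has_real_derivative Y t) (at t)"
      "Y 0 = a' i" "(Y has_real_derivative b' i) (at 0)"
      using assms i unfolding second_partials_def by meson
  moreover from this(1,4) have "\<forall>\<^sub>F t in nhds 0.
      ((\<lambda>t. f (x + t *\<^sub>R i) + g (x + t *\<^sub>R i)) has_real_derivative Z t + Y t) (at t)"
    by eventually_elim (rule DERIV_add)
  ultimately show "\<exists>Z. (\<forall>\<^sub>F t in nhds 0. ((\<lambda>t. f (x + t *\<^sub>R i) + g (x + t *\<^sub>R i)) has_real_derivative Z t) (at t)) \<and>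
        Z 0 = a i + a' i \<and> (Z has_real_derivative b i + b' i) (at 0)"
    by (intro exI[of _ "\<lambda>t. Z t + Y t"]) (auto intro!: derivative_intros)
qed

lemma second_partials_mult:
  assumes "second_partials f x a b" "second_partials g x a' b'"
  shows "second_partials (\<lambda>y. f y * g y) x (\<lambda>i. a i * g x + f x * a' i)
           (\<lambda>i. b i * g x + 2 * a i * a' i + f x * b' i)"
  unfolding second_partials_def
proof
  fix i :: 'a assume i: "i \<in> Basis"
  obtain Z Y where ZY: "\<forall>\<^sub>F t in nhds 0. ((\<lambda>t. f (x + t *\<^sub>R i)) has_real_derivative Z t) (at t)"
      "Z 0 = a i" "(Z has_real_derivative b i) (at 0)"
      "\<forall>\<^sub>F t in nhds 0. ((\<lambda>t. g (x + t *\<^sub>R i)) has_real_derivative Y t) (at t)"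
      "Y 0 = a' i" "(Y has_real_derivative b' i) (at 0)"
      using assms i unfolding second_partials_def by meson
  have d: "((\<lambda>t. f (x + t *\<^sub>R i)) has_real_derivative Z 0) (at 0)"
    "((\<lambda>t. g (x + t *\<^sub>R i)) has_real_derivative Y 0) (at 0)"
    using eventually_nhds_x_imp_x[OF ZY(1)] eventually_nhds_x_imp_x[OF ZY(4)] by auto
  show "\<exists>Z. (\<forall>\<^sub>F t in nhds 0. ((\<lambda>t. f (x + t *\<^sub>R i) * g (x + t *\<^sub>R i)) has_real_derivative Z t) (at t)) \<and>
        Z 0 = a i * g x + f x * a' i \<and>
        (Z has_real_derivative b i * g x + 2 * a i * a' i + f x * b' i) (at 0)"
  proof (intro exI[of _ "\<lambda>t. Z t * g (x + t *\<^sub>R i) + f (x + t *\<^sub>R i) * Y t"] conjI)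
    show "\<forall>\<^sub>F t in nhds 0. ((\<lambda>t. f (x + t *\<^sub>R i) * g (x + t *\<^sub>R i)) has_real_derivative
            Z t * g (x + t *\<^sub>R i) + f (x + t *\<^sub>R i) * Y t) (at t)"
      using ZY(1,4) by eventually_elim (auto intro!: derivative_eq_intros)
    show "((\<lambda>t. Z t * g (x + t *\<^sub>R i) + f (x + t *\<^sub>R i) * Y t) has_real_derivative
            b i * g x + 2 * a i * a' i + f x * b' i) (at 0)"
      by (rule derivative_eq_intros refl ZY d)+ (simp add: ZY algebra_simps)
  qed (simp add: ZY)
qed

lemma second_partials_chain:
  fixes h h' :: "real \<Rightarrow> real"
  assumes f: "second_partials f x a b"
    and h: "\<forall>\<^sub>F s in nhds (f x). (h has_real_derivative h' s) (at s)"
    and h': "(h' has_real_derivative h'') (at (f x))"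
  shows "second_partials (\<lambda>y. h (f y)) x (\<lambda>i. h' (f x) * a i) (\<lambda>i. h'' * (a i)\<^sup>2 + h' (f x) * b i)"
  unfolding second_partials_def
proof
  fix i :: 'a assume i: "i \<in> Basis"
  obtain Z where Z: "\<forall>\<^sub>F t in nhds 0. ((\<lambda>t. f (x + t *\<^sub>R i)) has_real_derivative Z t) (at t)"
      "Z 0 = a i" "(Z has_real_derivative b i) (at 0)"
      using f i unfolding second_partials_def by meson
  have d: "((\<lambda>t. f (x + t *\<^sub>R i)) has_real_derivative Z 0) (at 0)"
    using eventually_nhds_x_imp_x[OF Z(1)] by auto
  have lim: "filterlim (\<lambda>t. f (x + t *\<^sub>R i)) (nhds (f x)) (nhds 0)"
    using DERIV_isCont[OF d] tendsto_at_iff_tendsto_nhds[of "\<lambda>t. f (x + t *\<^sub>R i)" 0]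
    by (simp add: continuous_within)
  have ev: "\<forall>\<^sub>F t in nhds 0. (h has_real_derivative h' (f (x + t *\<^sub>R i))) (at (f (x + t *\<^sub>R i)))"
    by (rule eventually_compose_filterlim[OF h lim])
  have c: "((\<lambda>t. h' (f (x + t *\<^sub>R i))) has_real_derivative h'' * Z 0) (at 0)"
    by (rule DERIV_chain2[where f=h' and g="\<lambda>t. f (x + t *\<^sub>R i)"]) (use d h' in auto)
  show "\<exists>Z. (\<forall>\<^sub>F t in nhds 0. ((\<lambda>t. h (f (x + t *\<^sub>R i))) has_real_derivative Z t) (at t)) \<and>
        Z 0 = h' (f x) * a i \<and> (Z has_real_derivative h'' * (a i)\<^sup>2 + h' (f x) * b i) (at 0)"
  proof (intro exI[of _ "\<lambda>t. h' (f (x + t *\<^sub>R i)) * Z t"] conjI)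
    show "\<forall>\<^sub>F t in nhds 0. ((\<lambda>t. h (f (x + t *\<^sub>R i))) has_real_derivative
            h' (f (x + t *\<^sub>R i)) * Z t) (at t)"
      using ev Z(1) by eventually_elim (rule DERIV_chain2)
    show "((\<lambda>t. h' (f (x + t *\<^sub>R i)) * Z t) has_real_derivative h'' * (a i)\<^sup>2 + h' (f x) * b i) (at 0)"
      by (rule derivative_eq_intros refl Z c)+ (simp add: Z power2_eq_square)
  qed (simp add: Z)
qed

lemma second_partials_const: "second_partials (\<lambda>y. k) x (\<lambda>i. 0) (\<lambda>i. 0)"
  unfolding second_partials_def by (auto intro!: exI[of _ "\<lambda>_. 0"] always_eventually)

lemma second_partials_cmult:
  assumes "second_partials f x a b"
  shows "second_partials (\<lambda>y. k * f y) x (\<lambda>i. k * a i) (\<lambda>i. k * b i)"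
  using second_partials_mult[OF second_partials_const[of k] assms] by simp

lemma second_partials_uminus:
  assumes "second_partials f x a b"
  shows "second_partials (\<lambda>y. - f y) x (\<lambda>i. - a i) (\<lambda>i. - b i)"
  using second_partials_cmult[OF assms, of "-1"] by simp

lemma second_partials_diff:
  assumes "second_partials f x a b" "second_partials g x a' b'"
  shows "second_partials (\<lambda>y. f y - g y) x (\<lambda>i. a i - a' i) (\<lambda>i. b i - b' i)"
  using second_partials_add[OF assms(1) second_partials_uminus[OF assms(2)]] by simp

lemma frechet_line_derivative:
  fixes f :: "'a::euclidean_space \<Rightarrow> real"
  assumes "f differentiable (at (x + t *\<^sub>R i))"
  shows "((\<lambda>t. f (x + t *\<^sub>R i)) has_real_derivative frechet_derivative f (at (x + t *\<^sub>R i)) i) (at t)"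
proof -
  let ?D = "frechet_derivative f (at (x + t *\<^sub>R i))"
  have D: "(f has_derivative ?D) (at (x + t *\<^sub>R i))"
    using assms frechet_derivative_works by blast
  have l: "((\<lambda>t. x + t *\<^sub>R i) has_derivative (\<lambda>h. h *\<^sub>R i)) (at t)"
    by (auto intro!: derivative_eq_intros)
  have "((\<lambda>t. f (x + t *\<^sub>R i)) has_derivative (\<lambda>h. ?D (h *\<^sub>R i))) (at t)"
    using diff_chain_at[OF l D] by (simp add: o_def)
  moreover have "?D (h *\<^sub>R i) = ?D i * h" for h
    using has_derivative_bounded_linear[OF D] by (simp add: linear_simps)
  ultimately show ?thesis
    by (simp add: has_field_derivative_def)
qed

lemma second_partials_Ck_on:
  assumes "open S" "x \<in> S" "Ck_on 2 S u"
  shows "second_partials u x (\<lambda>i. frechet_derivative u (at x) i)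
           (\<lambda>i. frechet_derivative (\<lambda>y. frechet_derivative u (at y) i) (at x) i)"
  unfolding second_partials_def
proof
  fix i :: 'a
  have d: "u differentiable (at y)" "(\<lambda>y. frechet_derivative u (at y) i) differentiable (at y)"
    if "y \<in> S" for y
    using assms(3) that by (auto simp: numeral_2_eq_2)
  have ev: "\<forall>\<^sub>F t in nhds 0. x + t *\<^sub>R i \<in> S"
    using eventually_compose_filterlim[OF eventually_nhds_in_open[OF assms(1,2)] line_tendsto_nhds[of x i]] .
  show "\<exists>Z. (\<forall>\<^sub>F t in nhds 0. ((\<lambda>t. u (x + t *\<^sub>R i)) has_real_derivative Z t) (at t)) \<and>
        Z 0 = frechet_derivative u (at x) i \<and>
        (Z has_real_derivative frechet_derivative (\<lambda>y. frechet_derivative u (at y) i) (at x) i) (at 0)"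
  proof (intro exI[of _ "\<lambda>t. frechet_derivative u (at (x + t *\<^sub>R i)) i"] conjI)
    show "\<forall>\<^sub>F t in nhds 0. ((\<lambda>t. u (x + t *\<^sub>R i)) has_real_derivative
            frechet_derivative u (at (x + t *\<^sub>R i)) i) (at t)"
      using ev by eventually_elim (intro frechet_line_derivative d)
    show "((\<lambda>t. frechet_derivative u (at (x + t *\<^sub>R i)) i) has_real_derivative
            frechet_derivative (\<lambda>y. frechet_derivative u (at y) i) (at x) i) (at 0)"
      using frechet_line_derivative[of "\<lambda>y. frechet_derivative u (at y) i" x 0 i] d(2) assms(2) by simp
  qed simp
qed

section \<open>Double-well potentials\<close>

locale potential =
  fixes W W' W'' :: "real \<Rightarrow> real"
  assumes C2: "C2_half_line W W' W''" and well: "double_well W W' W''"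
begin

lemma W_deriv_within: "s \<ge> 0 \<Longrightarrow> (W has_real_derivative W' s) (at s within {0..})"
  and W'_deriv_within: "s \<ge> 0 \<Longrightarrow> (W' has_real_derivative W'' s) (at s within {0..})"
  and W''_cont: "continuous_on {0..} W''"
  using C2 unfolding C2_half_line_def by auto

lemma W_deriv: "s > 0 \<Longrightarrow> (W has_real_derivative W' s) (at s)"
  using W_deriv_within[of s] at_within_interior[of s "{0..}"] by simp

lemma W'_deriv: "s > 0 \<Longrightarrow> (W' has_real_derivative W'' s) (at s)"
  using W'_deriv_within[of s] at_within_interior[of s "{0..}"] by simp

lemma W_cont: "continuous_on {0..} W" and W'_cont: "continuous_on {0..} W'"
  using W_deriv_within W'_deriv_within
  by (auto intro!: DERIV_continuous_on)

lemma W_nonneg: "s \<ge> 0 \<Longrightarrow> W s \<ge> 0" and W_1: "W 1 = 0"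
  and W_pos: "0 \<le> s \<Longrightarrow> s < 1 \<Longrightarrow> W s > 0"
  and W'_neg: "0 < s \<Longrightarrow> s < 1 \<Longrightarrow> W' s < 0"
  using well unfolding double_well_def by auto

lemma W'_1: "W' 1 = 0"
  by (rule DERIV_local_min[of W _ 1 1])
     (use W_deriv[of 1] W_nonneg W_1 in \<open>auto simp: abs_less_iff\<close>)

lemma W'_nonpos: "0 < s \<Longrightarrow> s \<le> 1 \<Longrightarrow> W' s \<le> 0"
  using W'_neg[of s] W'_1 by (cases "s = 1") auto

text \<open>The nondegeneracy in (W5) in usable form. Since W' < 0 on (0,1), whichever of W'(0) and
  W''(0) is assumed nonzero must be negative, so -W' dominates a linear function near 0. This is
  what keeps u away from 0 deep inside \<Omega>.\<close>

lemma W'_upper_near_0: "\<exists>r>0. \<exists>k>0. \<forall>s\<in>{0<..<r}. W' s \<le> - k * s"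
proof (cases "W' 0 = 0")
  case True
  then have nz: "W'' 0 \<noteq> 0" using well unfolding double_well_def by auto
  have d: "(W' has_real_derivative W'' 0) (at 0 within {0..})" by (rule W'_deriv_within) simp
  have "\<not> W'' 0 > 0"
  proof
    assume "W'' 0 > 0"
    then obtain h where h: "h > 0" "\<And>x. x > 0 \<Longrightarrow> x < h \<Longrightarrow> W' 0 < W' x"
      using has_real_derivative_pos_inc_right[OF d] by auto
    have "0 < min h 1 / 2" "min h 1 / 2 < h" "min h 1 / 2 < 1" using h(1) by auto
    with h(2)[of "min h 1 / 2"] W'_neg[of "min h 1 / 2"] True show False by simp
  qed
  with nz have neg: "W'' 0 < 0" by simp
  have "((\<lambda>s. (W' s - W' 0) / (s - 0)) \<longlongrightarrow> W'' 0) (at 0 within {0..})"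
    using d unfolding has_field_derivative_iff .
  then have "\<forall>\<^sub>F s in at 0 within {0..}. W' s / s < W'' 0 / 2"
    using neg True by (intro order_tendstoD) auto
  then obtain r where r: "r > 0" "\<And>s. s \<in> {0..} \<Longrightarrow> s \<noteq> 0 \<Longrightarrow> dist s 0 < r \<Longrightarrow> W' s / s < W'' 0 / 2"
    unfolding eventually_at by blast
  have "W' s \<le> - (- W'' 0 / 2) * s" if "s \<in> {0<..<r}" for s
  proof -
    have "W' s / s < W'' 0 / 2" using r(2)[of s] that by (auto simp: dist_real_def)
    then show ?thesis using that by (simp add: field_simps)
  qed
  with r(1) neg show ?thesis by (intro exI[of _ r] conjI exI[of _ "- W'' 0 / 2"]) auto
next
  case False
  have lim: "(W' \<longlongrightarrow> W' 0) (at 0 within {0..})"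
    using W'_cont by (simp add: continuous_on_def)
  have pos: "W' 0 < 0"
  proof (rule ccontr)
    assume "\<not> W' 0 < 0"
    then have "W' 0 > 0" using False by simp
    then have "\<forall>\<^sub>F s in at 0 within {0..}. W' s > 0" using order_tendstoD(1)[OF lim] by simp
    then obtain r where r: "r > 0" "\<And>s. s \<in> {0..} \<Longrightarrow> s \<noteq> 0 \<Longrightarrow> dist s 0 < r \<Longrightarrow> W' s > 0"
      unfolding eventually_at by blast
    have "0 < min r 1 / 2" "min r 1 / 2 < r" "min r 1 / 2 < 1" using r(1) by auto
    with r(2)[of "min r 1 / 2"] W'_neg[of "min r 1 / 2"] show False by (simp add: dist_real_def)
  qed
  then have "\<forall>\<^sub>F s in at 0 within {0..}. W' s < W' 0 / 2" using order_tendstoD(2)[OF lim, of "W' 0 / 2"] by simp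
  then obtain r where r: "r > 0" "\<And>s. s \<in> {0..} \<Longrightarrow> s \<noteq> 0 \<Longrightarrow> dist s 0 < r \<Longrightarrow> W' s < W' 0 / 2"
    unfolding eventually_at by blast
  have "W' s \<le> - (- W' 0 / 2) * s" if "s \<in> {0<..<min r 1}" for s
  proof -
    have "W' s < W' 0 / 2" using r(2)[of s] that by (auto simp: dist_real_def)
    also have "W' 0 / 2 \<le> W' 0 / 2 * s" using that pos by (simp add: field_simps)
    finally show ?thesis by simp
  qed
  with r(1) pos show ?thesis by (intro exI[of _ "min r 1"] conjI exI[of _ "- W' 0 / 2"]) auto
qed

text \<open>Near 0 the linear bound applies; near 1 the bound comes from W'(1) = 0 and the lower
  bound on W''; on the compact interval in between W' has a negative maximum. The interval starts at
  \<open>min r g\<close> so that it is nonempty even if r exceeds g.\<close>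

lemma W'_upper: "\<exists>\<mu>>0. \<forall>s\<in>{0<..<1}. W' s \<le> - \<mu> * s * (1 - s)"
proof -
  obtain r k where rk: "r > 0" "k > 0" "\<And>s. s \<in> {0<..<r} \<Longrightarrow> W' s \<le> - k * s"
    using W'_upper_near_0 by blast
  obtain g K where g: "g \<in> {0<..<1}" "K > 0" "\<And>s. s \<ge> g \<Longrightarrow> W'' s \<ge> K"
    using well unfolding double_well_def by blast
  define A where "A = {min r g .. g}"
  have A: "compact A" "A \<noteq> {}" "continuous_on A W'"
    using rk g by (auto simp: A_def intro!: continuous_on_subset[OF W'_cont])
  then obtain q where q: "q \<in> A" "\<And>s. s \<in> A \<Longrightarrow> W' s \<le> W' q"
    using continuous_attains_sup[OF A] by blast
  have Wq: "W' q < 0" using q(1) rk g by (intro W'_neg) (auto simp: A_def)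
  define \<mu> where "\<mu> = min k (min K (- W' q))"
  have \<mu>: "\<mu> > 0" "\<mu> \<le> k" "\<mu> \<le> K" "\<mu> \<le> - W' q" using rk g Wq by (auto simp: \<mu>_def)
  have "W' s \<le> - \<mu> * s * (1 - s)" if s: "s \<in> {0<..<1}" for s
  proof -
    have "\<mu> * s * (1 - s) \<le> \<mu> * s * 1" "\<mu> * s * (1 - s) \<le> \<mu> * 1 * (1 - s)"
      using s \<mu> by (intro mult_left_mono mult_right_mono; simp)+
    then have bd: "\<mu> * s * (1 - s) \<le> \<mu> * s" "\<mu> * s * (1 - s) \<le> \<mu> * (1 - s)" by auto
    consider "s < r" | "s \<in> A" | "s > g" by (auto simp: A_def) (use s in force)
    then show ?thesis
    proof cases
      case 1
      then have "W' s \<le> - (k * s)" using rk(3)[of s] s by auto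
      moreover have "\<mu> * s \<le> k * s" using \<mu> s by (intro mult_right_mono) auto
      ultimately show ?thesis using bd by auto
    next
      case 2
      have "\<mu> * s \<le> - W' q * 1" using \<mu> s by (intro mult_mono) auto
      then show ?thesis using q(2)[OF 2] bd by auto
    next
      case 3
      obtain z where z: "s < z" "z < 1" "W' 1 - W' s = (1 - s) * W'' z"
        using MVT2[of s 1 W' W''] s W'_deriv by auto
      have "(1 - s) * \<mu> \<le> (1 - s) * W'' z" using g(3)[of z] z 3 s \<mu> by (intro mult_left_mono) auto
      moreover have "- W' s = (1 - s) * W'' z" "(1 - s) * \<mu> = \<mu> * (1 - s)" using z W'_1 by simp_all
      ultimately show ?thesis using bd by linarith
    qed
  qed
  with \<mu>(1) show ?thesis by blast
qed

lemma W_lower: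
  assumes \<mu>: "\<forall>s\<in>{0<..<1}. W' s \<le> - \<mu> * s * (1 - s)" and "\<mu> \<ge> 0" and s: "0 \<le> s" "s \<le> 1"
  shows "\<mu> / 6 * (1 - s)\<^sup>2 \<le> W s"
proof (cases "s = 1")
  case True then show ?thesis using W_1 by simp
next
  case False
  \<comment> \<open>The polynomial is the integral of r (1 - r) over [s,1]. Hence \<open>?E\<close>
    vanishes at 1 and its derivative W' + \<mu> s (1 - s) is nonpositive.\<close>
  let ?E = "\<lambda>s. W s - \<mu> * (1 / 6 - s\<^sup>2 / 2 + s ^ 3 / 3)"
  have "\<exists>z. s < z \<and> z < 1 \<and> ?E 1 - ?E s = (1 - s) * (W' z + \<mu> * z * (1 - z))"
  proof -
    have "continuous_on {s..1} ?E"
      using s by (intro continuous_intros continuous_on_subset[OF W_cont]) auto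
    note cont = this
    have "(?E has_real_derivative (W' z + \<mu> * z * (1 - z))) (at z)" if "s < z" "z < 1" for z
      using that s
      by (auto intro!: derivative_eq_intros W_deriv simp: algebra_simps power2_eq_square)
    note der = this
    obtain l z where lz: "s < z" "z < 1" "(?E has_real_derivative l) (at z)" "?E 1 - ?E s = (1 - s) * l"
    proof -
      have "\<exists>l z. s < z \<and> z < 1 \<and> (?E has_real_derivative l) (at z) \<and> ?E 1 - ?E s = (1 - s) * l"
        by (rule MVT) (use False s cont der in \<open>auto simp: real_differentiable_def\<close>)
      then show thesis using that by blast
    qed
    from DERIV_unique[OF lz(3) der[OF lz(1,2)]] lz show ?thesis by blast
  qed
  then obtain z where z: "s < z" "z < 1" "?E 1 - ?E s = (1 - s) * (W' z + \<mu> * z * (1 - z))" by blast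
  have "(1 - s) * (W' z + \<mu> * z * (1 - z)) \<le> 0"
    using z s \<mu>[rule_format, of z] by (intro mult_nonneg_nonpos) auto
  then have "\<mu> * (1 / 6 - s\<^sup>2 / 2 + s ^ 3 / 3) \<le> W s" using z(3) W_1 by simp
  moreover have "(1 - s)\<^sup>2 \<le> 6 * (1 / 6 - s\<^sup>2 / 2 + s ^ 3 / 3)"
  proof -
    have "6 * (1 / 6 - s\<^sup>2 / 2 + s ^ 3 / 3) - (1 - s)\<^sup>2 = 2 * s * (1 - s)\<^sup>2"
      by (simp add: algebra_simps power2_eq_square power3_eq_cube)
    moreover have "0 \<le> 2 * s * (1 - s)\<^sup>2" using s by simp
    ultimately show ?thesis by linarith
  qed
  then have "\<mu> / 6 * (1 - s)\<^sup>2 \<le> \<mu> / 6 * (6 * (1 / 6 - s\<^sup>2 / 2 + s ^ 3 / 3))"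
    using \<open>\<mu> \<ge> 0\<close> by (intro mult_left_mono) auto
  moreover have "\<mu> / 6 * (6 * (1 / 6 - s\<^sup>2 / 2 + s ^ 3 / 3)) = \<mu> * (1 / 6 - s\<^sup>2 / 2 + s ^ 3 / 3)"
    by simp
  ultimately show ?thesis by linarith
qed

lemma W'_lower: "\<exists>C>0. \<forall>s\<in>{0<..1}. - C * (1 - s) \<le> W' s"
proof -
  have A: "compact {0..1::real}" "{0..1::real} \<noteq> {}" "continuous_on {0..1} W''"
    by (auto intro!: continuous_on_subset[OF W''_cont])
  then obtain q where q: "\<And>s. s \<in> {0..1} \<Longrightarrow> W'' s \<le> W'' q"
    using continuous_attains_sup[OF A] by blast
  define C where "C = max 1 (W'' q)"
  have "- C * (1 - s) \<le> W' s" if s: "s \<in> {0<..1}" for s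
  proof (cases "s = 1")
    case False
    then obtain z where z: "s < z" "z < 1" "W' 1 - W' s = (1 - s) * W'' z"
      using MVT2[of s 1 W' W''] s W'_deriv by auto
    have "(1 - s) * W'' z \<le> (1 - s) * C"
      using q[of z] z s by (intro mult_left_mono) (auto simp: C_def)
    moreover have "- W' s = (1 - s) * W'' z" "- C * (1 - s) = - ((1 - s) * C)" using z W'_1 by simp_all
    ultimately show ?thesis by linarith
  qed (simp add: W'_1)
  then show ?thesis by (intro exI[of _ C]) (auto simp: C_def)
qed

text \<open>Integrates the bound for W' from s to 1. With \<open>W_lower\<close> it shows that W is
  comparable to (1 - s)^2, which is the form of the perturbation in the lower comparison.\<close>

lemma W_upper:
  assumes C: "\<forall>s\<in>{0<..1}. - C * (1 - s) \<le> W' s" and "C > 0" and s: "0 < s" "s \<le> 1"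
  shows "W s \<le> C * (1 - s)\<^sup>2"
proof (cases "s = 1")
  case False
  then obtain z where z: "s < z" "z < 1" "W 1 - W s = (1 - s) * W' z"
    using MVT2[of s 1 W W'] s W_deriv by auto
  have "- W' z \<le> C * (1 - z)" using C[rule_format, of z] z s by auto
  also have "\<dots> \<le> C * (1 - s)" using z \<open>C > 0\<close> by simp
  finally have "(1 - s) * (- W' z) \<le> (1 - s) * (C * (1 - s))" using s by (intro mult_left_mono) auto
  then show ?thesis using z(3) W_1 by (simp add: power2_eq_square algebra_simps)
qed (simp add: W_1)

lemma W'_superlinear: "\<exists>p>1. \<exists>c>0. \<forall>s>1. W' s \<ge> c * (s - 1) powr p"
  using well unfolding double_well_def by blast

end

section \<open>Bounds for positive solutions\<close>

lemma sum_inner_Basis_square: "(\<Sum>i\<in>Basis. (v \<bullet> i)\<^sup>2) = (norm (v::'a::euclidean_space))\<^sup>2"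
  unfolding power2_norm_eq_inner euclidean_inner[of v v] by (simp add: power2_eq_square)

locale positive_solution = potential W W' W'' for W W' W'' +
  fixes \<Omega> :: "'a::euclidean_space set" and u :: "'a \<Rightarrow> real"
  assumes open_domain: "open \<Omega>" and C2_u: "Ck_on 2 \<Omega> u"
    and pde: "\<And>x. x \<in> \<Omega> \<Longrightarrow> laplacian u x = W' (u x)"
    and u_pos: "\<And>x. x \<in> \<Omega> \<Longrightarrow> u x > 0"
    and u_cont: "continuous_on (closure \<Omega>) u"
    and u_frontier: "\<And>x. x \<in> frontier \<Omega> \<Longrightarrow> u x = 0"
begin

lemma closure_cases: "x \<in> closure \<Omega> \<Longrightarrow> x \<in> \<Omega> \<or> x \<in> frontier \<Omega>"
  using open_domain by (auto simp: frontier_def interior_open)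

lemma u_nonneg: "x \<in> closure \<Omega> \<Longrightarrow> u x \<ge> 0"
  using closure_cases u_frontier u_pos by fastforce

lemma u_isCont: "x \<in> \<Omega> \<Longrightarrow> isCont u x"
  using continuous_on_subset[OF u_cont closure_subset] open_domain
  by (simp add: continuous_on_eq_continuous_at)

lemma u_tendsto_nhds: "x \<in> \<Omega> \<Longrightarrow> filterlim u (nhds (u x)) (nhds x)"
  using u_isCont[of x] tendsto_at_iff_tendsto_nhds[of u x] by (simp add: continuous_within)

text \<open>At a local maximum of \<tau>(u) - \<zeta> the gradients agree and the Laplacian of the
  difference is nonpositive; the equation replaces the Laplacian of u by W'(u). The second
  conclusion allows |grad u|^2, which is unknown, to be traded for |grad \<zeta>|^2.\<close>

lemma touching_above:
  assumes x: "x \<in> \<Omega>"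
    and \<tau>: "\<forall>\<^sub>F s in nhds (u x). (\<tau> has_real_derivative \<tau>' s) (at s)"
    and \<tau>': "(\<tau>' has_real_derivative \<tau>'') (at (u x))"
    and \<zeta>: "second_partials \<zeta> x a b"
    and max: "\<forall>\<^sub>F y in nhds x. \<tau> (u y) - \<zeta> y \<le> \<tau> (u x) - \<zeta> x"
  shows "\<tau>'' * (\<Sum>i\<in>Basis. (frechet_derivative u (at x) i)\<^sup>2) + \<tau>' (u x) * W' (u x) \<le> (\<Sum>i\<in>Basis. b i)"
    and "(\<tau>' (u x))\<^sup>2 * (\<Sum>i\<in>Basis. (frechet_derivative u (at x) i)\<^sup>2) = (\<Sum>i\<in>Basis. (a i)\<^sup>2)"
proof -
  note * = second_partials_local_max[OF second_partials_diff[OF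
      second_partials_chain[OF second_partials_Ck_on[OF open_domain x C2_u] \<tau> \<tau>'] \<zeta>] max]
  show "\<tau>'' * (\<Sum>i\<in>Basis. (frechet_derivative u (at x) i)\<^sup>2) + \<tau>' (u x) * W' (u x) \<le> (\<Sum>i\<in>Basis. b i)"
    using *(2) pde[OF x, symmetric]
    by (simp add: laplacian_def sum_subtractf sum.distrib sum_distrib_left)
  have "(\<tau>' (u x) * frechet_derivative u (at x) i)\<^sup>2 = (a i)\<^sup>2" if "i \<in> Basis" for i
    using *(1)[OF that] by simp
  then show "(\<tau>' (u x))\<^sup>2 * (\<Sum>i\<in>Basis. (frechet_derivative u (at x) i)\<^sup>2) = (\<Sum>i\<in>Basis. (a i)\<^sup>2)"
    by (simp add: sum_distrib_left power_mult_distrib)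
qed

text \<open>At a maximum of ln (u - 1) + a ln h, where h = R^2 - |x - x0|^2, the touching inequality
  gives W'(u)/(u - 1) <= A R^2 / h^2, while (W4) gives W'(u)/(u - 1) >= c (u - 1)^(p-1). Comparing
  the values of the maximised function at x and at x0 yields \<theta> R^2 <= A, which is false for
  large R.\<close>

lemma u_le_1:
  assumes x0: "x0 \<in> \<Omega>"
  shows "u x0 \<le> 1"
proof (rule ccontr)
  assume "\<not> u x0 \<le> 1"
  then have u0: "u x0 > 1" by simp
  obtain p c where p: "p > 1" and c: "c > 0" "\<And>s. s > 1 \<Longrightarrow> W' s \<ge> c * (s - 1) powr p"
    using W'_superlinear by blast
  \<comment> \<open>The exponent that balances both sides: raising (u - 1) h^a to the power p - 1
    produces exactly h^2.\<close>
  define a where "a = 2 / (p - 1)"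
  have "p - 1 \<noteq> 0" using p by simp
  then have a: "a > 0" "a * (p - 1) = 2"
    using p nonzero_divide_eq_eq[of "p - 1" 2 a] a_def by (simp, metis)
  define n where "n = real DIM('a)"
  \<comment> \<open>Collects the coefficients of |grad \<zeta>|^2 and of the Laplacian of \<zeta>
    for \<zeta> = - a ln h, using h <= R^2 and |x - x0| <= R.\<close>
  define A where "A = 4 * a\<^sup>2 + 4 * a + 2 * a * n"
  define \<theta> where "\<theta> = c * (u x0 - 1) powr (p - 1)"
  have \<theta>: "\<theta> > 0" using c u0 by (simp add: \<theta>_def)
  have "\<exists>R>0. A < \<theta> * R\<^sup>2"
  proof -
    have "A \<ge> 0" using a by (simp add: A_def n_def)
    then have "A < \<theta> * (sqrt ((A + 1) / \<theta>))\<^sup>2" "sqrt ((A + 1) / \<theta>) > 0" using \<theta> by auto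
    then show ?thesis by blast
  qed
  then obtain R where R: "R > 0" "A < \<theta> * R\<^sup>2" by blast
  define h where "h = (\<lambda>y. R\<^sup>2 - (norm (y - x0))\<^sup>2)"
  \<comment> \<open>The ball need not lie in \<Omega>: h vanishes on the sphere and u - 1 is
    negative on the frontier, so a positive maximum is attained inside both.\<close>
  define K where "K = closure \<Omega> \<inter> cball x0 R"
  have h_nonneg: "h y \<ge> 0" if "y \<in> K" for y
    using that R by (auto simp: K_def h_def dist_norm norm_minus_commute intro!: power_mono)
  have "compact K" unfolding K_def by (intro closed_Int_compact) auto
  moreover have x0K: "x0 \<in> K" using x0 R closure_subset by (auto simp: K_def)
  moreover have "continuous_on K (\<lambda>y. (u y - 1) * h y powr a)"
    using h_nonneg a continuous_on_subset[OF u_cont, of K]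
    by (intro continuous_intros continuous_on_powr') (auto simp: K_def h_def intro!: continuous_intros)
  ultimately obtain x where x: "x \<in> K" and
    max: "\<And>y. y \<in> K \<Longrightarrow> (u y - 1) * h y powr a \<le> (u x - 1) * h x powr a"
    using continuous_attains_sup[of K "\<lambda>y. (u y - 1) * h y powr a"] by blast
  have h0: "h x0 = R\<^sup>2" by (simp add: h_def)
  have "(u x0 - 1) * h x0 powr a > 0" using u0 R h0 by simp
  with max[OF x0K] have pos: "(u x - 1) * h x powr a > 0" by linarith
  then have hx: "h x > 0" using h_nonneg[OF x] by (cases "h x = 0") auto
  have ux: "u x > 1" using pos by (simp add: zero_less_mult_iff)
  then have xO: "x \<in> \<Omega>" using closure_cases[of x] u_frontier[of x] x by (auto simp: K_def)
  have xb: "x \<in> ball x0 R"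
  proof -
    have "(norm (x - x0))\<^sup>2 < R\<^sup>2" using hx by (simp add: h_def)
    then have "norm (x - x0) < R" using R by (simp add: power2_less_imp_less)
    then show ?thesis by (simp add: dist_norm norm_minus_commute)
  qed
  define N where "N = norm (x - x0)"
  have N: "h x = R\<^sup>2 - N\<^sup>2" by (simp add: N_def h_def)
  have "\<forall>\<^sub>F y in nhds x. y \<in> \<Omega> \<inter> ball x0 R"
    using xO xb open_domain by (intro eventually_nhds_in_open) auto
  moreover have "\<forall>\<^sub>F y in nhds x. u y > 1"
    using u_tendsto_nhds[OF xO] ux by (rule order_tendstoD)
  ultimately have ev: "\<forall>\<^sub>F y in nhds x. ln (u y - 1) - (- a * ln (h y)) \<le> ln (u x - 1) - (- a * ln (h x))"
  proof eventually_elim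
    case (elim y)
    then have "norm (y - x0) < R" by (simp add: dist_norm norm_minus_commute)
    then have hy: "h y > 0" using R by (simp add: h_def power_strict_mono)
    have "y \<in> K" using elim closure_subset by (auto simp: K_def)
    from max[OF this] have "ln ((u y - 1) * h y powr a) \<le> ln ((u x - 1) * h x powr a)"
      using elim hy pos by (subst ln_le_cancel_iff) auto
    then show ?case using elim hy hx ux by (simp add: ln_mult ln_powr)
  qed
  have sp: "second_partials (\<lambda>y. - a * ln (h y)) x (\<lambda>i. (- a / h x) * (0 - 2 * ((x - x0) \<bullet> i)))
     (\<lambda>i. (a / (h x)\<^sup>2) * (0 - 2 * ((x - x0) \<bullet> i))\<^sup>2 + (- a / h x) * (0 - 2))"
  proof (rule second_partials_chain[where h="\<lambda>s. - a * ln s" and h'="\<lambda>s. - a / s"])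
    show "second_partials h x (\<lambda>i. 0 - 2 * ((x - x0) \<bullet> i)) (\<lambda>i. 0 - 2)"
      unfolding h_def by (intro second_partials_diff second_partials_const second_partials_norm_square)
    have "\<forall>\<^sub>F s in nhds (h x). s \<in> {0<..}" using hx by (intro eventually_nhds_in_open) auto
    then show "\<forall>\<^sub>F s in nhds (h x). ((\<lambda>s. - a * ln s) has_real_derivative - a / s) (at s)"
      by eventually_elim (auto intro!: derivative_eq_intros)
    show "((\<lambda>s. - a / s) has_real_derivative a / (h x)\<^sup>2) (at (h x))"
      using hx by (auto intro!: derivative_eq_intros simp: power2_eq_square)
  qed
  define D where "D = (\<Sum>i\<in>Basis. (frechet_derivative u (at x) i)\<^sup>2)"
  have evu: "\<forall>\<^sub>F s in nhds (u x). ((\<lambda>s. ln (s - 1)) has_real_derivative 1 / (s - 1)) (at s)"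
  proof -
    have "\<forall>\<^sub>F s in nhds (u x). s \<in> {1<..}" using ux by (intro eventually_nhds_in_open) auto
    then show ?thesis by eventually_elim (auto intro!: derivative_eq_intros)
  qed
  have du: "((\<lambda>s. 1 / (s - 1)) has_real_derivative - 1 / (u x - 1)\<^sup>2) (at (u x))"
    using ux by (auto intro!: derivative_eq_intros simp: power2_eq_square)
  note t = touching_above[OF xO evu du sp ev, folded D_def]
  have s1: "(\<Sum>i\<in>Basis. ((- a / h x) * (0 - 2 * ((x - x0) \<bullet> i)))\<^sup>2) = 4 * a\<^sup>2 * N\<^sup>2 / (h x)\<^sup>2"
    by (simp add: power_mult_distrib power_divide sum_distrib_left[symmetric]
        sum_divide_distrib[symmetric] sum_inner_Basis_square N_def)
  have s2: "(\<Sum>i\<in>Basis. (a / (h x)\<^sup>2) * (0 - 2 * ((x - x0) \<bullet> i))\<^sup>2 + (- a / h x) * (0 - 2)) =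
      4 * a * N\<^sup>2 / (h x)\<^sup>2 + 2 * a * n / h x"
    by (simp add: sum.distrib power_mult_distrib power_divide sum_distrib_left[symmetric]
        sum_divide_distrib[symmetric] sum_inner_Basis_square N_def n_def ac_simps)
  have "W' (u x) / (u x - 1) \<le> 4 * a\<^sup>2 * N\<^sup>2 / (h x)\<^sup>2 + (4 * a * N\<^sup>2 / (h x)\<^sup>2 + 2 * a * n / h x)"
    using t unfolding s1 s2 by (simp add: power_divide)
  also have "\<dots> \<le> A * R\<^sup>2 / (h x)\<^sup>2"
  proof -
    have "N\<^sup>2 \<le> R\<^sup>2" using hx N by simp
    then have "4 * a\<^sup>2 * N\<^sup>2 + 4 * a * N\<^sup>2 + 2 * a * n * h x \<le> 4 * a\<^sup>2 * R\<^sup>2 + 4 * a * R\<^sup>2 + 2 * a * n * R\<^sup>2"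
      using a N by (intro add_mono mult_left_mono) (auto simp: n_def)
    then have "(4 * a\<^sup>2 * N\<^sup>2 + 4 * a * N\<^sup>2 + 2 * a * n * h x) / (h x)\<^sup>2 \<le> A * R\<^sup>2 / (h x)\<^sup>2"
      by (intro divide_right_mono) (auto simp: A_def algebra_simps)
    then show ?thesis using hx by (simp add: add_divide_distrib power2_eq_square)
  qed
  finally have 1: "W' (u x) / (u x - 1) * (h x)\<^sup>2 \<le> A * R\<^sup>2" using hx by (simp add: field_simps)
  have "c * (u x - 1) powr p / (u x - 1) \<le> W' (u x) / (u x - 1)"
    using c(2)[OF ux] ux by (intro divide_right_mono) auto
  then have "c * (u x - 1) powr (p - 1) \<le> W' (u x) / (u x - 1)"
    using ux by (simp add: powr_diff)
  then have "c * (u x - 1) powr (p - 1) * (h x)\<^sup>2 \<le> W' (u x) / (u x - 1) * (h x)\<^sup>2"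
    by (rule mult_right_mono) simp
  with 1 have 2: "c * ((u x - 1) powr (p - 1) * (h x)\<^sup>2) \<le> A * R\<^sup>2" by simp
  have eq: "((s - 1) * r powr a) powr (p - 1) = (s - 1) powr (p - 1) * r\<^sup>2" if "s > 1" "r > 0" for s r :: real
    using that a(2) by (simp add: powr_mult powr_powr)
  have "((u x0 - 1) * h x0 powr a) powr (p - 1) \<le> ((u x - 1) * h x powr a) powr (p - 1)"
    using max[OF x0K] u0 p by (intro powr_mono2) auto
  then have "(u x0 - 1) powr (p - 1) * (R\<^sup>2)\<^sup>2 \<le> (u x - 1) powr (p - 1) * (h x)\<^sup>2"
    using u0 ux hx R by (simp add: eq h0)
  then have "\<theta> * (R\<^sup>2)\<^sup>2 \<le> A * R\<^sup>2" using 2 c(1) mult_left_mono[of _ _ c] unfolding \<theta>_def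
    by (smt (verit) mult.assoc)
  then have "(\<theta> * R\<^sup>2) * R\<^sup>2 \<le> A * R\<^sup>2" by (simp add: power2_eq_square mult.assoc)
  moreover have "R\<^sup>2 > 0" using R by simp
  ultimately have "\<theta> * R\<^sup>2 \<le> A" by (simp only: mult_le_cancel_right_pos)
  with R show False by simp
qed

text \<open>While u < 1/2, -W'(u) >= (\<mu>/2) u, a reaction too strong for a positive function on a
  large ball. The square of q plays the role of an explicit test function in place of a Dirichlet
  eigenfunction.\<close>

lemma u_ge_half_deep:
  "\<exists>r0>0. \<forall>r\<ge>r0. \<forall>p. cball p r \<subseteq> \<Omega> \<longrightarrow> u p \<ge> 1 / 2"
proof -
  obtain \<mu> where \<mu>: "\<mu> > 0" "\<And>s. s \<in> {0<..<1} \<Longrightarrow> W' s \<le> - \<mu> * s * (1 - s)"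
    using W'_upper by blast
  define A where "A = 4 * real DIM('a) + 8"
  \<comment> \<open>Chosen so that A^2 < 16 \<mu> r^2 for r >= r0, which makes the discriminant of
    \<mu> r^2 q^2 / 2 - A q + 8 negative.\<close>
  define r0 where "r0 = sqrt ((A\<^sup>2 + 1) / (16 * \<mu>))"
  have r0: "r0 > 0" using \<mu> by (simp add: r0_def add_nonneg_pos)
  have r0sq: "16 * \<mu> * r0\<^sup>2 = A\<^sup>2 + 1" using \<mu> by (simp add: r0_def add_nonneg_pos)
  have "u p \<ge> 1 / 2" if r: "r \<ge> r0" and sub: "cball p r \<subseteq> \<Omega>" for r p
  proof (rule ccontr)
    assume up: "\<not> u p \<ge> 1 / 2"
    have rpos: "r > 0" using r r0 by simp
    have "r0\<^sup>2 \<le> r\<^sup>2" using r r0 by (intro power_mono) auto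
    then have "16 * \<mu> * r0\<^sup>2 \<le> 16 * \<mu> * r\<^sup>2" using \<mu> by simp
    then have Ar: "A\<^sup>2 < 16 * \<mu> * r\<^sup>2" using r0sq by linarith
    \<comment> \<open>The Laplacian of q^2 equals (8 - A q) / r^2. Near the sphere, where the
      reaction term of size q^2 is negligible, the 8 coming from the gradient of q settles the sign;
      q without the square would not give this.\<close>
    define q where "q = (\<lambda>y. 1 - (norm (y - p))\<^sup>2 / r\<^sup>2)"
    have cont: "continuous_on (cball p r) (\<lambda>y. (q y)\<^sup>2 / u y)"
    proof (intro continuous_intros)
      show "continuous_on (cball p r) q" using rpos unfolding q_def by (auto intro!: continuous_intros)
      show "continuous_on (cball p r) u"
        by (rule continuous_on_subset[OF u_cont]) (use sub closure_subset in blast)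
      show "\<forall>x\<in>cball p r. u x \<noteq> 0" using sub u_pos by fastforce
    qed
    have pc: "p \<in> cball p r" using rpos by simp
    then obtain x where x: "x \<in> cball p r" and
      max: "\<And>y. y \<in> cball p r \<Longrightarrow> (q y)\<^sup>2 / u y \<le> (q x)\<^sup>2 / u x"
      using continuous_attains_sup[OF compact_cball _ cont] by blast
    \<comment> \<open>The least factor with M u >= q^2 on the ball. From u p < 1/2 follows M > 2,
      and then u x < 1/2 because q x <= 1.\<close>
    define M where "M = (q x)\<^sup>2 / u x"
    have xO: "x \<in> \<Omega>" and ux: "u x > 0" and upos: "u p > 0"
      using u_pos subsetD[OF sub x] subsetD[OF sub pc] by auto
    have "2 < 1 / u p" using up upos by (simp add: field_simps)
    also have "1 / u p \<le> M" using max[OF pc] by (simp add: q_def M_def)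
    finally have M: "M > 2" .
    have Mu: "M * u x = (q x)\<^sup>2" using ux by (simp add: M_def)
    have qnz: "q x \<noteq> 0" using M by (auto simp: M_def)
    have nr: "norm (x - p) \<le> r" using x by (simp add: dist_norm norm_minus_commute)
    then have "(norm (x - p))\<^sup>2 \<le> r\<^sup>2" using rpos by (intro power_mono) auto
    then have q01: "0 \<le> q x" "q x \<le> 1" using rpos by (auto simp: q_def)
    have xb: "x \<in> ball p r"
      using nr qnz rpos by (cases "norm (x - p) = r") (auto simp: q_def dist_norm norm_minus_commute)
    have "2 * u x < M * u x" using M ux by simp
    also have "\<dots> \<le> 1" using Mu q01 by (simp add: power_le_one)
    finally have ux2: "u x < 1 / 2" by simp
    have "\<forall>\<^sub>F y in nhds x. y \<in> ball p r" using xb by (intro eventually_nhds_in_open) auto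
    then have ev: "\<forall>\<^sub>F y in nhds x. - M * u y - (- (q y)\<^sup>2) \<le> - M * u x - (- (q x)\<^sup>2)"
    proof eventually_elim
      case (elim y)
      then have "y \<in> cball p r" by auto
      then have "u y > 0" "(q y)\<^sup>2 / u y \<le> M" using max[of y] sub u_pos by (auto simp: M_def)
      then show ?case using Mu by (simp add: divide_le_eq)
    qed
    define N where "N = norm (x - p)"
    define g1 where "g1 = (\<lambda>s. (2 / r\<^sup>2) * (1 - s / r\<^sup>2))"
    have sp: "second_partials (\<lambda>y. - (q y)\<^sup>2) x (\<lambda>i. g1 (N\<^sup>2) * (2 * ((x - p) \<bullet> i)))
       (\<lambda>i. (- 2 / r ^ 4) * (2 * ((x - p) \<bullet> i))\<^sup>2 + g1 (N\<^sup>2) * 2)"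
      unfolding q_def N_def
    proof (rule second_partials_chain[where h="\<lambda>s. - (1 - s / r\<^sup>2)\<^sup>2" and h'=g1])
      show "\<forall>\<^sub>F s in nhds ((norm (x - p))\<^sup>2). ((\<lambda>s. - (1 - s / r\<^sup>2)\<^sup>2) has_real_derivative g1 s) (at s)"
        using rpos by (intro always_eventually allI) (auto simp: g1_def field_simps intro!: derivative_eq_intros)
      show "(g1 has_real_derivative - 2 / r ^ 4) (at ((norm (x - p))\<^sup>2))"
        using rpos unfolding g1_def
        by (auto intro!: derivative_eq_intros simp: power2_eq_square power4_eq_xxxx)
    qed (rule second_partials_norm_square)
    have du: "\<forall>\<^sub>F s in nhds (u x). ((\<lambda>s. - M * s) has_real_derivative - M) (at s)"
      by (intro always_eventually allI) (auto intro!: derivative_eq_intros)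
    have "- M * W' (u x) \<le> (\<Sum>i\<in>Basis. (- 2 / r ^ 4) * (2 * ((x - p) \<bullet> i))\<^sup>2 + g1 (N\<^sup>2) * 2)"
      using touching_above(1)[OF xO du DERIV_const sp ev] by simp
    also have "\<dots> = - 8 * N\<^sup>2 / r ^ 4 + 2 * real DIM('a) * g1 (N\<^sup>2)"
      by (simp add: sum.distrib sum_subtractf power_mult_distrib sum_distrib_left[symmetric]
        sum_divide_distrib[symmetric] sum_negf sum_inner_Basis_square N_def)
    also have "\<dots> = (A * q x - 8) / r\<^sup>2"
      using rpos by (simp add: g1_def q_def A_def N_def[symmetric] field_simps power2_eq_square power4_eq_xxxx)
    finally have "- M * W' (u x) \<le> (A * q x - 8) / r\<^sup>2" .
    moreover have "\<mu> * (q x)\<^sup>2 / 2 \<le> - M * W' (u x)"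
    proof -
      have "W' (u x) \<le> - (\<mu> * u x * (1 - u x))" using \<mu>(2)[of "u x"] ux ux2 by simp
      moreover have "\<mu> * u x * (1 / 2) \<le> \<mu> * u x * (1 - u x)"
        using \<mu> ux ux2 by (intro mult_left_mono) auto
      ultimately have "\<mu> * u x / 2 \<le> - W' (u x)" by simp
      then have "M * (\<mu> * u x / 2) \<le> M * (- W' (u x))" using M by (intro mult_left_mono) auto
      moreover have "M * (\<mu> * u x / 2) = \<mu> * (q x)\<^sup>2 / 2" unfolding Mu[symmetric] by simp
      ultimately show ?thesis by linarith
    qed
    ultimately have "\<mu> * (q x)\<^sup>2 / 2 \<le> (A * q x - 8) / r\<^sup>2" by linarith
    then have 1: "\<mu> * r\<^sup>2 * (q x)\<^sup>2 / 2 \<le> A * q x - 8" using rpos by (simp add: field_simps)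
    have "0 \<le> (A * q x - 16)\<^sup>2" by simp
    then have "32 * (A * q x) \<le> A\<^sup>2 * (q x)\<^sup>2 + 256" by (simp add: power2_eq_square algebra_simps)
    moreover have "A\<^sup>2 * (q x)\<^sup>2 < 16 * \<mu> * r\<^sup>2 * (q x)\<^sup>2"
      using Ar qnz by (intro mult_strict_right_mono) auto
    ultimately show False using 1 by simp
  qed
  with r0 show ?thesis by blast
qed

end

section \<open>The hodograph transform\<close>

text \<open>For \<Phi> = W this is the inverse of the one-dimensional profile: g' = sqrt (2 W(g))
  says that T(g(t)) = t. It straightens the profile into the height and vanishes where u
  does.\<close>

definition hodograph :: "(real \<Rightarrow> real) \<Rightarrow> real \<Rightarrow> real" where
  "hodograph \<Phi> s = integral {0..s} (\<lambda>r. 1 / sqrt (2 * \<Phi> r))"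

lemma hodograph_0: "hodograph \<Phi> 0 = 0"
  by (simp add: hodograph_def)

lemma hodograph_deriv_within:
  assumes "continuous_on {0..b} \<Phi>" "\<And>s. s \<in> {0..b} \<Longrightarrow> \<Phi> s > 0" "s \<in> {0..b}"
  shows "(hodograph \<Phi> has_real_derivative 1 / sqrt (2 * \<Phi> s)) (at s within {0..b})"
proof -
  have "continuous_on {0..b} (\<lambda>r. 1 / sqrt (2 * \<Phi> r))"
    using assms(1,2) by (intro continuous_intros) (auto, fastforce)
  from integral_has_real_derivative[OF this assms(3)] show ?thesis
    by (simp add: hodograph_def[abs_def])
qed

lemma hodograph_continuous_on:
  assumes "continuous_on {0..b} \<Phi>" "\<And>s. s \<in> {0..b} \<Longrightarrow> \<Phi> s > 0"
  shows "continuous_on {0..b} (hodograph \<Phi>)"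
  using hodograph_deriv_within[OF assms] by (rule DERIV_continuous_on)

lemma hodograph_mvt:
  assumes "continuous_on {0..b} \<Phi>" "\<And>s. s \<in> {0..b} \<Longrightarrow> \<Phi> s > 0" "0 \<le> r" "r < s" "s \<le> b"
  obtains z where "r < z" "z < s" "hodograph \<Phi> s - hodograph \<Phi> r = (s - r) / sqrt (2 * \<Phi> z)"
proof -
  have "\<exists>z\<in>{r<..<s}. hodograph \<Phi> s - hodograph \<Phi> r = (1 / sqrt (2 * \<Phi> z)) * (s - r)"
  proof (rule mvt_simple[OF \<open>r < s\<close>])
    fix z assume z: "r \<le> z" "z \<le> s"
    have "(hodograph \<Phi> has_real_derivative 1 / sqrt (2 * \<Phi> z)) (at z within {r..s})"
      by (rule has_field_derivative_subset[OF hodograph_deriv_within[OF assms(1,2)]]) (use assms z in auto)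
    then show "(hodograph \<Phi> has_derivative (*) (1 / sqrt (2 * \<Phi> z))) (at z within {r..s})"
      by (simp add: has_field_derivative_def)
  qed
  then show thesis using that by auto
qed

lemma hodograph_strict_mono:
  assumes "continuous_on {0..b} \<Phi>" "\<And>s. s \<in> {0..b} \<Longrightarrow> \<Phi> s > 0" "0 \<le> r" "r < s" "s \<le> b"
  shows "hodograph \<Phi> r < hodograph \<Phi> s"
proof -
  obtain z where z: "r < z" "z < s" "hodograph \<Phi> s - hodograph \<Phi> r = (s - r) / sqrt (2 * \<Phi> z)"
    using hodograph_mvt[OF assms] by blast
  have "\<Phi> z > 0" using z assms by (intro assms(2)) auto
  then have "(s - r) / sqrt (2 * \<Phi> z) > 0" using assms(4) by (intro divide_pos_pos) auto
  with z(3) show ?thesis by linarith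
qed

lemma hodograph_nonneg:
  assumes "continuous_on {0..b} \<Phi>" "\<And>s. s \<in> {0..b} \<Longrightarrow> \<Phi> s > 0" "0 \<le> s" "s \<le> b"
  shows "hodograph \<Phi> s \<ge> 0"
  using hodograph_strict_mono[OF assms(1,2), of 0 s] assms(3,4) hodograph_0[of \<Phi>]
  by (cases "s = 0") auto

context positive_solution
begin

text \<open>At a contact point \<open>|\<nabla>u|\<^sup>2 = 2 \<Phi>(u) |\<nabla>\<zeta>|\<^sup>2\<close>, so the gradient of \<open>u\<close> drops out of the
  equation for \<open>hodograph \<Phi> \<circ> u\<close>; the sign \<open>\<sigma>\<close> selects contact from above or from below.\<close>

lemma hodograph_touching:
  assumes x: "x \<in> \<Omega>" and ub: "u x < b"
    and \<Phi>: "continuous_on {0..b} \<Phi>" "\<And>s. s \<in> {0..b} \<Longrightarrow> \<Phi> s > 0"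
    and \<Phi>': "(\<Phi> has_real_derivative d) (at (u x))"
    and \<zeta>: "second_partials \<zeta> x a c"
    and \<sigma>: "\<sigma> = 1 \<or> \<sigma> = -1"
    and max: "\<forall>\<^sub>F y in nhds x. \<sigma> * (hodograph \<Phi> (u y) - \<zeta> y) \<le> \<sigma> * (hodograph \<Phi> (u x) - \<zeta> x)"
  shows "\<sigma> * ((W' (u x) - d * (\<Sum>i\<in>Basis. (a i)\<^sup>2)) / sqrt (2 * \<Phi> (u x))) \<le> \<sigma> * (\<Sum>i\<in>Basis. c i)"
proof -
  define F where "F = sqrt (2 * \<Phi> (u x))"
  have ux: "u x \<in> {0<..<b}" using u_pos[OF x] ub by simp
  have \<Phi>pos: "\<Phi> (u x) > 0" using ux by (intro \<Phi>(2)) auto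
  have F: "F > 0" "F\<^sup>2 = 2 * \<Phi> (u x)" using \<Phi>pos by (auto simp: F_def)
  have "\<forall>\<^sub>F s in nhds (u x). s \<in> {0<..<b}" using ux by (intro eventually_nhds_in_open) auto
  then have ev: "\<forall>\<^sub>F s in nhds (u x).
      ((\<lambda>s. \<sigma> * hodograph \<Phi> s) has_real_derivative \<sigma> * (1 / sqrt (2 * \<Phi> s))) (at s)"
  proof eventually_elim
    case (elim s)
    then have "(hodograph \<Phi> has_real_derivative 1 / sqrt (2 * \<Phi> s)) (at s)"
      using hodograph_deriv_within[OF \<Phi>, of s] at_within_interior[of s "{0..b}"] by simp
    then show ?case by (rule DERIV_cmult)
  qed
  have "((\<lambda>s. sqrt (2 * \<Phi> s)) has_real_derivative d / F) (at (u x))"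
    using \<Phi>pos by (auto intro!: derivative_eq_intros \<Phi>' simp: F_def field_simps)
  note d1 = this
  have d2: "((\<lambda>s. \<sigma> * (1 / sqrt (2 * \<Phi> s))) has_real_derivative \<sigma> * (- (d / F) / F\<^sup>2)) (at (u x))"
    using F DERIV_divide[OF DERIV_const[of 1] d1] by (intro DERIV_cmult) (simp add: F_def power2_eq_square)
  have "\<forall>\<^sub>F y in nhds x. \<sigma> * hodograph \<Phi> (u y) - \<sigma> * \<zeta> y \<le> \<sigma> * hodograph \<Phi> (u x) - \<sigma> * \<zeta> x"
    using max by (simp add: right_diff_distrib)
  note t = touching_above[OF x ev d2 second_partials_cmult[OF \<zeta>] this]
  define D where "D = (\<Sum>i\<in>Basis. (frechet_derivative u (at x) i)\<^sup>2)"
  have \<sigma>2: "\<sigma>\<^sup>2 = 1" using \<sigma> by auto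
  have "D / F\<^sup>2 = (\<Sum>i\<in>Basis. (a i)\<^sup>2)"
    using t(2) \<sigma>2 F(1) unfolding D_def[symmetric] F_def[symmetric]
    by (simp add: power_mult_distrib power_divide)
  then have "\<sigma> * (- (d / F) / F\<^sup>2) * D = \<sigma> * (- d / F * (\<Sum>i\<in>Basis. (a i)\<^sup>2))"
    by (metis (no_types, lifting) divide_minus_left mult.assoc times_divide_eq_left times_divide_eq_right)
  then have "\<sigma> * (- d / F * (\<Sum>i\<in>Basis. (a i)\<^sup>2)) + \<sigma> * (1 / F) * W' (u x) \<le> \<sigma> * (\<Sum>i\<in>Basis. c i)"
    using t(1) unfolding D_def[symmetric] F_def[symmetric] by (simp add: sum_distrib_left)
  then show ?thesis unfolding F_def[symmetric] by (simp add: diff_divide_distrib algebra_simps)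
qed

end

text \<open>What a coercive epigraph contributes, with \<open>e\<close> the vertical direction and
  \<open>m\<close> the minimum of \<phi>. Boundedness of the slabs provides maxima and bounds
  functions of the horizontal variables.\<close>

locale slab_solution = positive_solution W W' W'' \<Omega> u
  for W W' W'' and \<Omega> :: "'a::euclidean_space set" and u +
  fixes e :: 'a and m :: real
  assumes norm_e: "norm e = 1"
    and above: "\<And>x. x \<in> closure \<Omega> \<Longrightarrow> m \<le> x \<bullet> e"
    and slab_bounded: "\<And>X. bounded {x \<in> closure \<Omega>. x \<bullet> e \<le> X}"
begin

lemma slab_max:
  fixes f :: "'a \<Rightarrow> real"
  assumes cont: "continuous_on {x \<in> closure \<Omega>. x \<bullet> e \<le> X} f"
    and x0: "x0 \<in> closure \<Omega>" "x0 \<bullet> e \<le> X" "r < f x0"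
    and fr: "\<And>x. x \<in> frontier \<Omega> \<Longrightarrow> x \<bullet> e \<le> X \<Longrightarrow> f x \<le> r"
    and top: "\<And>x. x \<in> closure \<Omega> \<Longrightarrow> x \<bullet> e = X \<Longrightarrow> f x \<le> r"
  obtains x where "x \<in> \<Omega>" "x \<bullet> e < X" "f x0 \<le> f x" "\<forall>\<^sub>F y in nhds x. f y \<le> f x"
proof -
  let ?K = "{x \<in> closure \<Omega>. x \<bullet> e \<le> X}"
  have "?K = closure \<Omega> \<inter> {x. e \<bullet> x \<le> X}" by (auto simp: inner_commute)
  then have "closed ?K" by (simp add: closed_Int closed_halfspace_le)
  then have "compact ?K" using slab_bounded compact_eq_bounded_closed by blast
  then obtain x where x: "x \<in> ?K" "\<And>y. y \<in> ?K \<Longrightarrow> f y \<le> f x"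
    using continuous_attains_sup[OF _ _ cont] x0 by blast
  have ge: "f x0 \<le> f x" using x(2)[of x0] x0 by simp
  have xO: "x \<in> \<Omega>" using closure_cases[of x] fr[of x] x(1) ge x0(3) by auto
  have xX: "x \<bullet> e < X" using top[of x] x(1) ge x0(3) by (cases "x \<bullet> e = X") auto
  have "open (\<Omega> \<inter> {y. e \<bullet> y < X})" using open_domain open_halfspace_lt by blast
  then have "\<forall>\<^sub>F y in nhds x. y \<in> \<Omega> \<inter> {y. e \<bullet> y < X}"
    using xO xX by (intro eventually_nhds_in_open) (auto simp: inner_commute)
  then have "\<forall>\<^sub>F y in nhds x. f y \<le> f x"
    by eventually_elim (use x(2) closure_subset[of \<Omega>] in \<open>auto simp: inner_commute\<close>)
  with xO xX ge show thesis using that by blast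
qed

lemma frontier_above: "x \<in> frontier \<Omega> \<Longrightarrow> m \<le> x \<bullet> e"
  using above by (simp add: frontier_def)

text \<open>Comparison with 1 - E. Where u exceeds it, 1 - u < E, so W'(u) >= - C E; contact would
  force W'(u) <= - k^2 E, and k^2 = C + 1. The strict inequality places u inside the interval on
  which \<open>hodograph\<close> is differentiable.\<close>

lemma u_less_1:
  assumes x0: "x0 \<in> \<Omega>"
  shows "u x0 < 1"
proof (rule ccontr)
  assume "\<not> u x0 < 1"
  obtain C where C: "C > 0" "\<And>s. s \<in> {0<..1} \<Longrightarrow> - C * (1 - s) \<le> W' s" using W'_lower by blast
  define k where "k = sqrt (C + 1)"
  have k: "k > 0" "k\<^sup>2 = C + 1" using C by (auto simp: k_def)
  define E where "E = (\<lambda>y. exp (- k * (y \<bullet> e - m)))"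
  define X where "X = x0 \<bullet> e + 1"
  define f where "f = (\<lambda>y. u y - (1 - E y))"
  \<comment> \<open>The value of E at height X, which bounds f at the top because u <= 1. As X lies
    above x0, r is smaller than E x0.\<close>
  define r where "r = exp (- k * (X - m))"
  have "r < E x0" using k by (simp add: r_def E_def X_def algebra_simps)
  then have fx0: "f x0 > r" using \<open>\<not> u x0 < 1\<close> by (simp add: f_def)
  have cont: "continuous_on {x \<in> closure \<Omega>. x \<bullet> e \<le> X} f" unfolding f_def E_def
    by (intro continuous_intros continuous_on_subset[OF u_cont]) auto
  have fr: "f x \<le> r" if "x \<in> frontier \<Omega>" "x \<bullet> e \<le> X" for x
  proof -
    have "E x \<le> 1" using frontier_above[OF that(1)] k by (simp add: E_def)
    moreover have "0 < r" by (simp add: r_def)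
    ultimately show ?thesis using u_frontier[OF that(1)] by (simp add: f_def)
  qed
  have top: "f x \<le> r" if "x \<in> closure \<Omega>" "x \<bullet> e = X" for x
    using closure_cases[OF that(1)] u_le_1[of x] u_frontier[of x] that(2) by (auto simp: f_def E_def r_def)
  have "x0 \<in> closure \<Omega>" "x0 \<bullet> e \<le> X" using x0 closure_subset[of \<Omega>] by (auto simp: X_def)
  from slab_max[OF cont this fx0 fr top] obtain x where
    x: "x \<in> \<Omega>" "f x0 \<le> f x" "\<forall>\<^sub>F y in nhds x. f y \<le> f x" by blast
  have ev: "\<forall>\<^sub>F y in nhds x. u y - (1 - E y) \<le> u x - (1 - E x)" using x(3) by (simp add: f_def)
  have sp: "second_partials (\<lambda>y. 1 - E y) x (\<lambda>i. k * E x * (i \<bullet> e)) (\<lambda>i. - k\<^sup>2 * E x * (i \<bullet> e)\<^sup>2 + k * E x * 0)"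
    unfolding E_def
    by (rule second_partials_chain[where h="\<lambda>s. 1 - exp (- k * (s - m))" and h'="\<lambda>s. k * exp (- k * (s - m))"])
       (auto intro!: second_partials_inner always_eventually derivative_eq_intros simp: power2_eq_square)
  have id: "\<forall>\<^sub>F s in nhds (u x). ((\<lambda>s. s) has_real_derivative 1) (at s)"
    by (intro always_eventually allI) (auto intro!: derivative_eq_intros)
  have "W' (u x) \<le> (\<Sum>i\<in>Basis. - k\<^sup>2 * E x * (i \<bullet> e)\<^sup>2)"
    using touching_above(1)[OF x(1) id DERIV_const sp ev] by simp
  also have "\<dots> = - k\<^sup>2 * E x"
    using sum_inner_Basis_square[of e] norm_e by (simp add: sum_negf sum_distrib_left[symmetric] inner_commute)
  finally have "W' (u x) \<le> - (C + 1) * E x" by (simp add: k)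
  moreover have "- C * (1 - u x) \<le> W' (u x)" using C(2) u_pos[OF x(1)] u_le_1[OF x(1)] by simp
  moreover have "C * (1 - u x) \<le> C * E x"
  proof -
    have "0 < r" by (simp add: r_def)
    then have "f x > 0" using fx0 x(2) by linarith
    then show ?thesis using C by (simp add: f_def)
  qed
  moreover have "E x > 0" by (simp add: E_def)
  ultimately show False by (simp add: algebra_simps)
qed

lemma u_less_1_closure: "x \<in> closure \<Omega> \<Longrightarrow> u x < 1"
  using closure_cases[of x] u_less_1 u_frontier by auto

text \<open>The height is harmonic with gradient of length 1, so contact would require W' - \<Phi>'
  = \<delta> to be nonpositive. The term \<delta> (2 - s) supplies this sign and keeps \<Phi> >=
  \<delta> on [0,1], whereas the integral for W alone diverges at 1.\<close>

lemma hodograph_le_height: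
  assumes \<delta>: "\<delta> > 0" and \<Phi>: "\<Phi> = (\<lambda>s. W s + \<delta> * (2 - s))" and x0: "x0 \<in> closure \<Omega>"
  shows "hodograph \<Phi> (u x0) \<le> x0 \<bullet> e - m"
proof (rule ccontr)
  assume contr: "\<not> hodograph \<Phi> (u x0) \<le> x0 \<bullet> e - m"
  have \<Phi>c: "continuous_on {0..1} \<Phi>"
    unfolding \<Phi> by (intro continuous_intros continuous_on_subset[OF W_cont]) auto
  have \<Phi>p: "\<Phi> s > 0" if "s \<in> {0..1}" for s
    using that W_nonneg[of s] \<delta> unfolding \<Phi> by (intro add_nonneg_pos) auto
  \<comment> \<open>High enough for T(u) <= T(1) <= X - m to hold at the top and for the slab to
    contain x0.\<close>
  define X where "X = max (x0 \<bullet> e) (m + hodograph \<Phi> 1)"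
  define f where "f = (\<lambda>y. hodograph \<Phi> (u y) - y \<bullet> e)"
  have u01: "u y \<in> {0..1}" if "y \<in> closure \<Omega>" for y
    using u_nonneg u_less_1_closure that by fastforce
  have "continuous_on (closure \<Omega>) (\<lambda>y. hodograph \<Phi> (u y))"
    by (rule continuous_on_compose2[OF hodograph_continuous_on[OF \<Phi>c \<Phi>p] u_cont]) (use u01 in auto)
  then have cont: "continuous_on {x \<in> closure \<Omega>. x \<bullet> e \<le> X} f"
    unfolding f_def by (intro continuous_intros) (auto intro: continuous_on_subset)
  have fr: "f x \<le> - m" if "x \<in> frontier \<Omega>" for x
    using u_frontier[OF that] frontier_above[OF that] by (simp add: f_def hodograph_0)
  have top: "f x \<le> - m" if "x \<in> closure \<Omega>" "x \<bullet> e = X" for x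
  proof -
    have "hodograph \<Phi> (u x) \<le> hodograph \<Phi> 1"
      using hodograph_strict_mono[OF \<Phi>c \<Phi>p, of "u x" 1] u_nonneg u_less_1_closure that by force
    then show ?thesis using that by (simp add: f_def X_def)
  qed
  have "x0 \<bullet> e \<le> X" "- m < f x0" using contr by (auto simp: X_def f_def)
  from slab_max[OF cont x0 this fr top] obtain x where
    x: "x \<in> \<Omega>" "\<forall>\<^sub>F y in nhds x. f y \<le> f x" by blast
  have "(\<Phi> has_real_derivative W' (u x) - \<delta>) (at (u x))"
    unfolding \<Phi> using u_pos[OF x(1)] by (auto intro!: derivative_eq_intros W_deriv)
  from hodograph_touching[OF x(1) u_less_1[OF x(1)] \<Phi>c \<Phi>p this second_partials_inner, of 1 e]
  have "(W' (u x) - (W' (u x) - \<delta>) * (\<Sum>i\<in>Basis. (i \<bullet> e)\<^sup>2)) / sqrt (2 * \<Phi> (u x)) \<le> 0"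
    using x(2) by (simp add: f_def)
  moreover have "(\<Sum>i\<in>Basis. (i \<bullet> e)\<^sup>2) = 1"
    using sum_inner_Basis_square[of e] norm_e by (simp add: inner_commute)
  moreover have "\<delta> / sqrt (2 * \<Phi> (u x)) > 0"
    using \<delta> \<Phi>p[of "u x"] u_pos[OF x(1)] u_less_1[OF x(1)] by (intro divide_pos_pos) auto
  ultimately show False by simp
qed

end

section \<open>Strict comparison with the half space\<close>

text \<open>The profile is convex and increasing near \<open>0\<close>, convex and decreasing near \<open>\<tau>\<close>, which absorbs
  the drift \<open>K\<close> at the two zeros; in between, a large \<open>k\<close> does.\<close>

lemma barrier_profile:
  fixes K \<tau> :: real
  assumes "K \<ge> 0" "\<tau> > 0"
  obtains s s' s'' :: "real \<Rightarrow> real" and k A A' :: real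
  where "\<And>t. (s has_real_derivative s' t) (at t)" "\<And>t. (s' has_real_derivative s'' t) (at t)"
    "s \<tau> = 0" "k \<ge> 0" "A > 0" "A' > 0"
    "\<And>t. t \<in> {0..\<tau>} \<Longrightarrow> 0 \<le> s t" "\<And>t. t \<in> {0..\<tau>} \<Longrightarrow> s t \<le> A' * t"
    "\<And>t. t \<in> {0..\<tau> / 2} \<Longrightarrow> A * t \<le> s t"
    "\<And>t. t \<in> {0..\<tau>} \<Longrightarrow> k\<^sup>2 * s t + s'' t > 2 * K * max 0 (s' t)"
proof -
  \<comment> \<open>Gives s''(0) = 2 (K + 1) \<tau>^2, which exceeds 2 K s'(0) = 2 K \<tau>^2; the
    summand 2 / \<tau> cancels the term - 2 \<tau>.\<close>
  define B where "B = K + 2 / \<tau> + 1"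
  have B: "B > 0" using assms by (simp add: B_def add_nonneg_pos)
  have B\<tau>: "B * \<tau>\<^sup>2 - 2 * \<tau> = (K + 1) * \<tau>\<^sup>2"
    using assms by (simp add: B_def field_simps power2_eq_square)
  \<comment> \<open>The zero at 0 is simple, which gives the linear lower bound; the zero at \<tau>
    is double, so that s' and with it the drift vanish there.\<close>
  define s where "s = (\<lambda>t. t * (1 + B * t) * (\<tau> - t)\<^sup>2)"
  define s' where "s' = (\<lambda>t. \<tau>\<^sup>2 + 2 * (B * \<tau>\<^sup>2 - 2 * \<tau>) * t + 3 * (1 - 2 * B * \<tau>) * t\<^sup>2 + 4 * B * t ^ 3)"
  define s'' where "s'' = (\<lambda>t. 2 * (B * \<tau>\<^sup>2 - 2 * \<tau>) + 6 * (1 - 2 * B * \<tau>) * t + 12 * B * t\<^sup>2)"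
  have s_nonneg: "0 \<le> s t" if "t \<in> {0..\<tau>}" for t using that B by (simp add: s_def)
  have s_pos: "0 < s t" if "t \<in> {0<..<\<tau>}" for t using that B by (simp add: s_def add_pos_pos)
  define g where "g = (\<lambda>t. s'' t - 2 * K * max 0 (s' t))"
  have g0: "g 0 > 0"
  proof -
    have "s'' 0 = 2 * (K + 1) * \<tau>\<^sup>2" "s' 0 = \<tau>\<^sup>2" using B\<tau> by (auto simp: s''_def s'_def)
    then have "g 0 = 2 * \<tau>\<^sup>2" by (simp add: g_def algebra_simps)
    then show ?thesis using assms by simp
  qed
  have g\<tau>: "g \<tau> > 0"
  proof -
    have "s' \<tau> = 0" by (simp add: s'_def algebra_simps power2_eq_square power3_eq_cube)
    moreover have "s'' \<tau> = 2 * B * \<tau>\<^sup>2 + 2 * \<tau>" by (simp add: s''_def algebra_simps power2_eq_square)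
    ultimately show ?thesis using assms B by (simp add: g_def add_pos_pos)
  qed
  \<comment> \<open>The set where k = 0 would not suffice. It is compact and avoids 0 and \<tau>, so
    s has a positive minimum on it and a large k compensates for g.\<close>
  define N where "N = {t \<in> {0..\<tau>}. g t \<le> 0}"
  have gc: "continuous_on {0..\<tau>} g" unfolding g_def s''_def s'_def
    by (intro continuous_intros)
  have "N = {0..\<tau>} \<inter> g -` {..0}" by (auto simp: N_def)
  then have "closed N" using continuous_closed_preimage[OF gc] by simp
  moreover have "bounded N" by (rule bounded_subset[of "{0..\<tau>}"]) (auto simp: N_def)
  ultimately have cN: "compact N" by (simp add: compact_eq_bounded_closed)
  have "\<exists>k\<ge>0. \<forall>t\<in>{0..\<tau>}. k\<^sup>2 * s t + g t > 0"
  proof (cases "N = {}")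
    case True
    then show ?thesis by (intro exI[of _ 0]) (auto simp: N_def)
  next
    case False
    have sc: "continuous_on N s" unfolding s_def by (intro continuous_intros)
    have gcN: "continuous_on N g" by (rule continuous_on_subset[OF gc]) (auto simp: N_def)
    obtain t1 where t1: "t1 \<in> N" "\<And>t. t \<in> N \<Longrightarrow> s t1 \<le> s t"
      using continuous_attains_inf[OF cN False sc] by blast
    obtain t2 where t2: "t2 \<in> N" "\<And>t. t \<in> N \<Longrightarrow> g t2 \<le> g t"
      using continuous_attains_inf[OF cN False gcN] by blast
    have "t1 \<noteq> 0" "t1 \<noteq> \<tau>" using t1(1) g0 g\<tau> by (auto simp: N_def)
    then have st1: "s t1 > 0" using t1(1) by (intro s_pos) (auto simp: N_def)
    have gt2: "g t2 \<le> 0" using t2(1) by (simp add: N_def)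
    define k where "k = sqrt ((1 - g t2) / s t1)"
    have k: "k \<ge> 0" "k\<^sup>2 * s t1 = 1 - g t2" using st1 gt2 by (auto simp: k_def)
    have "k\<^sup>2 * s t + g t > 0" if "t \<in> {0..\<tau>}" for t
    proof (cases "t \<in> N")
      case True
      have "k\<^sup>2 * s t1 \<le> k\<^sup>2 * s t" using t1(2)[OF True] by (intro mult_left_mono) auto
      then show ?thesis using k(2) t2(2)[OF True] by linarith
    next
      case False
      then show ?thesis using that s_nonneg[OF that] by (auto simp: N_def intro!: add_nonneg_pos)
    qed
    with k(1) show ?thesis by blast
  qed
  then obtain k where k: "k \<ge> 0" "\<And>t. t \<in> {0..\<tau>} \<Longrightarrow> k\<^sup>2 * s t + g t > 0" by blast
  show thesis
  proof (rule that[of s s' s'' k "\<tau>\<^sup>2 / 4" "(1 + B * \<tau>) * \<tau>\<^sup>2"])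
    show "(s has_real_derivative s' t) (at t)" for t
      unfolding s_def s'_def
      by (auto intro!: derivative_eq_intros simp: algebra_simps power2_eq_square power3_eq_cube)
    show "(s' has_real_derivative s'' t) (at t)" for t
      unfolding s'_def s''_def
      by (auto intro!: derivative_eq_intros simp: algebra_simps power2_eq_square)
    show "s t \<le> (1 + B * \<tau>) * \<tau>\<^sup>2 * t" if "t \<in> {0..\<tau>}" for t
    proof -
      have "(1 + B * t) * (\<tau> - t)\<^sup>2 \<le> (1 + B * \<tau>) * \<tau>\<^sup>2"
        using that B by (intro mult_mono power_mono add_mono) auto
      then have "t * ((1 + B * t) * (\<tau> - t)\<^sup>2) \<le> t * ((1 + B * \<tau>) * \<tau>\<^sup>2)"
        using that by (intro mult_left_mono) auto
      then show ?thesis by (simp add: s_def ac_simps)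
    qed
    show "\<tau>\<^sup>2 / 4 * t \<le> s t" if "t \<in> {0..\<tau> / 2}" for t
    proof -
      have "1 * (\<tau> / 2)\<^sup>2 \<le> (1 + B * t) * (\<tau> - t)\<^sup>2"
        using that B assms by (intro mult_mono power_mono) auto
      then have "t * (1 * (\<tau> / 2)\<^sup>2) \<le> t * ((1 + B * t) * (\<tau> - t)\<^sup>2)"
        using that by (intro mult_left_mono) auto
      then show ?thesis by (simp add: s_def power_divide ac_simps)
    qed
    show "k\<^sup>2 * s t + s'' t > 2 * K * max 0 (s' t)" if "t \<in> {0..\<tau>}" for t
      using k(2)[OF that] by (simp add: g_def)
  qed (use k assms B s_nonneg in \<open>auto simp: s_def add_pos_pos\<close>)
qed

context slab_solution
begin

text \<open>T(u) is compared with Q = t - \<epsilon> E s(t) instead of t. On the frontier Q >= 0, at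
  the top Q = t because s vanishes there, and inside the profile inequality excludes contact. The
  gain \<eta> = \<epsilon> E(y) A is fixed before \<delta>, so it survives the limit \<delta> ->
  0.\<close>

lemma hodograph_strictly_below_height:
  assumes d: "norm d = 1" "d \<bullet> e = 0" and y: "y \<bullet> e = m"
  shows "\<exists>\<tau>>0. \<exists>\<eta>>0. \<forall>\<delta>\<in>{0<..1}. \<forall>t\<in>{0<..<\<tau>}. y + t *\<^sub>R e \<in> \<Omega> \<longrightarrow>
       hodograph (\<lambda>s. W s + \<delta> * (2 - s)) (u (y + t *\<^sub>R e)) \<le> (1 - \<eta>) * t"
proof -
  obtain \<mu> where \<mu>: "\<mu> > 0" "\<forall>s\<in>{0<..<1}. W' s \<le> - \<mu> * s * (1 - s)" using W'_upper by blast
  obtain C where C: "C > 0" "\<forall>s\<in>{0<..1}. - C * (1 - s) \<le> W' s" using W'_lower by blast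
  define \<Phi> where "\<Phi> = (\<lambda>\<delta> s. W s + \<delta> * (2 - s))"
  \<comment> \<open>For \<delta> <= 1 one has \<Phi> <= C + 2 on (0,1/2), hence T(1/2) >= \<tau>. So
    u <= 1/2 up to height \<tau>, whatever \<delta> is.\<close>
  define \<tau> where "\<tau> = (1 / 2) / sqrt (2 * (C + 2))"
  \<comment> \<open>Bounds - W'(u) / sqrt (2 \<Phi>(u)) while u <= 1/2: there - W' <= C and 2 \<Phi>
    >= 2 W >= 2 (\<mu>/6) (1/2)^2 = \<mu>/12, independently of \<delta>.\<close>
  define K where "K = C / sqrt (\<mu> / 12)"
  have \<tau>: "\<tau> > 0" and K: "K > 0" using C \<mu> by (auto simp: \<tau>_def K_def)
  have \<Phi>c: "continuous_on {0..1} (\<Phi> \<delta>)" for \<delta> :: real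
    unfolding \<Phi>_def by (intro continuous_intros continuous_on_subset[OF W_cont]) auto
  have \<Phi>p: "\<Phi> \<delta> s > 0" if "\<delta> > 0" "s \<in> {0..1}" for \<delta> s :: real
    using that W_nonneg[of s] unfolding \<Phi>_def by (intro add_nonneg_pos) auto
  have half: "u x \<le> 1 / 2" if x: "x \<in> closure \<Omega>" "x \<bullet> e - m \<le> \<tau>" and \<delta>: "\<delta> \<in> {0<..1}" for x and \<delta> :: real
  proof (rule ccontr)
    assume "\<not> u x \<le> 1 / 2"
    then have 1: "hodograph (\<Phi> \<delta>) (1 / 2) < hodograph (\<Phi> \<delta>) (u x)"
      using hodograph_strict_mono[OF \<Phi>c \<Phi>p, of \<delta> "1 / 2" "u x"] u_less_1_closure[OF x(1)] \<delta> by auto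
    obtain z where z: "0 < z" "z < 1 / 2"
      "hodograph (\<Phi> \<delta>) (1 / 2) - hodograph (\<Phi> \<delta>) 0 = (1 / 2 - 0) / sqrt (2 * \<Phi> \<delta> z)"
      using hodograph_mvt[OF \<Phi>c \<Phi>p, of \<delta> 0 "1 / 2"] \<delta> by auto
    have "W z \<le> C * (1 - z)\<^sup>2" using W_upper[OF C(2,1), of z] z by auto
    also have "\<dots> \<le> C * 1" using z C by (intro mult_left_mono) (auto simp: power_le_one)
    finally have "W z \<le> C" by simp
    moreover have "\<delta> * (2 - z) \<le> 1 * 2" using z \<delta> by (intro mult_mono) auto
    ultimately have "\<Phi> \<delta> z \<le> C + 2" by (simp add: \<Phi>_def)
    then have "sqrt (2 * \<Phi> \<delta> z) \<le> sqrt (2 * (C + 2))" by simp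
    moreover have "sqrt (2 * \<Phi> \<delta> z) > 0" using \<Phi>p[of \<delta> z] \<delta> z by simp
    ultimately have "\<tau> \<le> hodograph (\<Phi> \<delta>) (1 / 2)"
      using z(3) unfolding \<tau>_def hodograph_0 by (simp add: frac_le)
    also note 1
    also have "hodograph (\<Phi> \<delta>) (u x) \<le> x \<bullet> e - m"
      using hodograph_le_height[of \<delta> "\<Phi> \<delta>" x] \<delta> x by (auto simp: \<Phi>_def)
    finally show False using x by simp
  qed
  obtain s s' s'' k A A' where s: "\<And>t. (s has_real_derivative s' t) (at t)"
    "\<And>t. (s' has_real_derivative s'' t) (at t)"
    "s \<tau> = 0" "k \<ge> 0" "A > 0" "A' > 0"
    "\<And>t. t \<in> {0..\<tau>} \<Longrightarrow> 0 \<le> s t" "\<And>t. t \<in> {0..\<tau>} \<Longrightarrow> s t \<le> A' * t"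
    "\<And>t. t \<in> {0..\<tau> / 2} \<Longrightarrow> A * t \<le> s t"
    "\<And>t. t \<in> {0..\<tau>} \<Longrightarrow> k\<^sup>2 * s t + s'' t > 2 * K * max 0 (s' t)"
    using barrier_profile[of K \<tau>] K \<tau> by (metis less_imp_le)
  \<comment> \<open>As d is a unit vector orthogonal to e, the Laplacian of E s(t) is E (k^2 s +
    s''): the variation along d supplies the term k^2 s.\<close>
  define E where "E = (\<lambda>y. exp (k * (y \<bullet> d)))"
  have Epos: "E y > 0" for y by (simp add: E_def)
  obtain \<rho> where \<rho>: "\<And>x. x \<in> closure \<Omega> \<Longrightarrow> x \<bullet> e \<le> m + \<tau> \<Longrightarrow> norm x \<le> \<rho>"
    using slab_bounded[of "m + \<tau>"] unfolding bounded_iff by blast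
  \<comment> \<open>With E <= exp (k \<rho>) on the bounded slab and s(t) <= A' t, this choice makes
    \<epsilon> E s(t) <= t, that is Q >= 0 on the frontier.\<close>
  define \<epsilon> where "\<epsilon> = 1 / (exp (k * \<rho>) * A')"
  have \<epsilon>: "\<epsilon> > 0" using s(6) by (simp add: \<epsilon>_def)
  have \<epsilon>E: "\<epsilon> * E x * A' \<le> 1" if "x \<in> closure \<Omega>" "x \<bullet> e \<le> m + \<tau>" for x
  proof -
    have "x \<bullet> d \<le> norm x * norm d" by (rule norm_cauchy_schwarz)
    then have "x \<bullet> d \<le> \<rho>" using \<rho>[OF that] d by simp
    then have "E x \<le> exp (k * \<rho>)" using s(4) by (simp add: E_def mult_left_mono)
    then show ?thesis using s(6) by (simp add: \<epsilon>_def divide_le_eq)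
  qed
  define Q where "Q = (\<lambda>y. (y \<bullet> e - m) - \<epsilon> * (E y * s (y \<bullet> e - m)))"
  have below: "hodograph (\<Phi> \<delta>) (u x0) \<le> Q x0"
    if \<delta>: "\<delta> \<in> {0<..1}" and x0: "x0 \<in> closure \<Omega>" "x0 \<bullet> e \<le> m + \<tau>" for \<delta> :: real and x0
  proof (rule ccontr)
    assume contr: "\<not> hodograph (\<Phi> \<delta>) (u x0) \<le> Q x0"
    define f where "f = (\<lambda>y. hodograph (\<Phi> \<delta>) (u y) - Q y)"
    note \<Phi>p\<delta> = \<Phi>p[of \<delta>]
    have \<delta>0: "\<delta> > 0" using \<delta> by simp
    have u01: "u y \<in> {0..1}" if "y \<in> closure \<Omega>" for y
      using u_nonneg u_less_1_closure that by fastforce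
    have "continuous_on (closure \<Omega>) (\<lambda>y. hodograph (\<Phi> \<delta>) (u y))"
      by (rule continuous_on_compose2[OF hodograph_continuous_on[OF \<Phi>c \<Phi>p\<delta>[OF \<delta>0]] u_cont])
         (use u01 in auto)
    moreover have sc: "continuous_on UNIV s" using s(1) by (blast intro: DERIV_continuous_on)
    have "continuous_on S (\<lambda>y. s (y \<bullet> e - m))" for S
      by (rule continuous_on_compose2[OF sc]) (auto intro!: continuous_intros)
    ultimately have cont: "continuous_on {x \<in> closure \<Omega>. x \<bullet> e \<le> m + \<tau>} f"
      unfolding f_def Q_def E_def by (intro continuous_intros) (auto intro: continuous_on_subset)
    have fr: "f x \<le> 0" if "x \<in> frontier \<Omega>" "x \<bullet> e \<le> m + \<tau>" for x
    proof -
      have x: "x \<in> closure \<Omega>" using that by (simp add: frontier_def)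
      let ?t = "x \<bullet> e - m"
      have t: "?t \<in> {0..\<tau>}" using that above[OF x] by simp
      have "\<epsilon> * (E x * s ?t) \<le> \<epsilon> * (E x * (A' * ?t))"
        using s(8)[OF t] \<epsilon> Epos[of x] by (intro mult_left_mono) auto
      also have "\<dots> = \<epsilon> * E x * A' * ?t" by simp
      also have "\<dots> \<le> 1 * ?t" using \<epsilon>E[OF x that(2)] t by (intro mult_right_mono) auto
      finally show ?thesis using u_frontier[OF that(1)] by (simp add: f_def Q_def hodograph_0)
    qed
    have top: "f x \<le> 0" if "x \<in> closure \<Omega>" "x \<bullet> e = m + \<tau>" for x
      using hodograph_le_height[of \<delta> "\<Phi> \<delta>" x] that \<delta> s(3) by (auto simp: f_def Q_def \<Phi>_def)
    have "0 < f x0" using contr by (simp add: f_def)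
    from slab_max[OF cont x0 this fr top] obtain x where
      x: "x \<in> \<Omega>" "x \<bullet> e < m + \<tau>" "\<forall>\<^sub>F y in nhds x. f y \<le> f x" by blast
    have xc: "x \<in> closure \<Omega>" using x closure_subset by auto
    define t where "t = x \<bullet> e - m"
    have t: "t \<in> {0..\<tau>}" using above[OF xc] x by (simp add: t_def)
    define a where "a = (\<lambda>i. i \<bullet> ((1 - \<epsilon> * E x * s' t) *\<^sub>R e - (\<epsilon> * k * E x * s t) *\<^sub>R d))"
    define c where "c = (\<lambda>i. - \<epsilon> * (k\<^sup>2 * E x * (i \<bullet> d)\<^sup>2 * s t
        + 2 * k * E x * s' t * ((i \<bullet> d) * (i \<bullet> e)) + E x * s'' t * (i \<bullet> e)\<^sup>2))"
    have sp: "second_partials Q x a c"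
    proof -
      have spE: "second_partials E x (\<lambda>i. k * E x * (i \<bullet> d)) (\<lambda>i. k\<^sup>2 * E x * (i \<bullet> d)\<^sup>2 + k * E x * 0)"
        unfolding E_def
        by (rule second_partials_chain[where h="\<lambda>s. exp (k * s)" and h'="\<lambda>s. k * exp (k * s)"])
           (auto intro!: second_partials_inner always_eventually derivative_eq_intros simp: power2_eq_square)
      have shift: "((\<lambda>r. g (r - m)) has_real_derivative g' (r - m)) (at r)"
        if "\<And>t. (g has_real_derivative g' t) (at t)" for g g' :: "real \<Rightarrow> real" and r
      proof -
        have "((\<lambda>r. r - m) has_real_derivative 1) (at r)" by (auto intro!: derivative_eq_intros)
        from DERIV_chain2[OF that this] show ?thesis by simp
      qed
      have sps: "second_partials (\<lambda>y. s (y \<bullet> e - m)) x (\<lambda>i. s' t * (i \<bullet> e)) (\<lambda>i. s'' t * (i \<bullet> e)\<^sup>2 + s' t * 0)"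
        unfolding t_def
        by (rule second_partials_chain[where h="\<lambda>r. s (r - m)" and h'="\<lambda>r. s' (r - m)"])
           (intro second_partials_inner always_eventually allI shift[OF s(1)] shift[OF s(2)])+
      note * = second_partials_diff[OF second_partials_diff[OF second_partials_inner[of e]
          second_partials_const[of m]] second_partials_cmult[OF second_partials_mult[OF spE sps], of \<epsilon>]]
      have "(\<lambda>i. i \<bullet> e - 0 - \<epsilon> * (k * E x * (i \<bullet> d) * s (x \<bullet> e - m) + E x * (s' t * (i \<bullet> e)))) = a"
        by (auto simp: a_def t_def inner_diff_right algebra_simps)
      moreover have "(\<lambda>i. 0 - 0 - \<epsilon> * ((k\<^sup>2 * E x * (i \<bullet> d)\<^sup>2 + k * E x * 0) * s (x \<bullet> e - m)
          + 2 * (k * E x * (i \<bullet> d)) * (s' t * (i \<bullet> e)) + E x * (s'' t * (i \<bullet> e)\<^sup>2 + s' t * 0))) = c"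
        by (auto simp: c_def t_def algebra_simps)
      ultimately show ?thesis using * unfolding Q_def by simp
    qed
    have eed: "(\<Sum>i\<in>Basis. (i \<bullet> e)\<^sup>2) = 1" "(\<Sum>i\<in>Basis. (i \<bullet> d)\<^sup>2) = 1"
      "(\<Sum>i\<in>Basis. (i \<bullet> d) * (i \<bullet> e)) = 0"
      using sum_inner_Basis_square[of e] sum_inner_Basis_square[of d] norm_e d euclidean_inner[of d e]
      by (auto simp: inner_commute)
    have sumc: "(\<Sum>i\<in>Basis. c i) = - \<epsilon> * E x * (k\<^sup>2 * s t + s'' t)"
    proof -
      have "(\<Sum>i\<in>Basis. c i) = - \<epsilon> * (k\<^sup>2 * E x * s t * (\<Sum>i\<in>Basis. (i \<bullet> d)\<^sup>2)
         + 2 * k * E x * s' t * (\<Sum>i\<in>Basis. (i \<bullet> d) * (i \<bullet> e)) + E x * s'' t * (\<Sum>i\<in>Basis. (i \<bullet> e)\<^sup>2))"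
        unfolding c_def sum_distrib_left sum.distrib[symmetric] by (intro sum.cong) (auto simp: ac_simps)
      then show ?thesis by (simp add: eed algebra_simps)
    qed
    define P where "P = (\<Sum>i\<in>Basis. (a i)\<^sup>2)"
    have P: "P = (1 - \<epsilon> * E x * s' t)\<^sup>2 + (\<epsilon> * k * E x * s t)\<^sup>2"
    proof -
      define \<alpha> where "\<alpha> = 1 - \<epsilon> * E x * s' t"
      define \<beta> where "\<beta> = \<epsilon> * k * E x * s t"
      have "P = (norm (\<alpha> *\<^sub>R e - \<beta> *\<^sub>R d))\<^sup>2"
        using sum_inner_Basis_square[of "\<alpha> *\<^sub>R e - \<beta> *\<^sub>R d"]
        by (simp add: P_def a_def \<alpha>_def \<beta>_def inner_commute)
      also have "\<dots> = \<alpha>\<^sup>2 + \<beta>\<^sup>2"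
      proof -
        have "e \<bullet> e = 1" "d \<bullet> d = 1" "e \<bullet> d = 0"
          using norm_e d by (auto simp: norm_eq_1 inner_commute)
        then show ?thesis unfolding power2_norm_eq_inner
          by (simp add: inner_diff_left inner_diff_right power2_eq_square d)
      qed
      finally show ?thesis by (simp add: \<alpha>_def \<beta>_def)
    qed
    \<comment> \<open>The squared gradient P of Q can fall below 1 only through the term linear in
      s', and only where s' > 0. This is the drift that the profile was built to absorb.\<close>
    have P1: "1 - P \<le> 2 * (\<epsilon> * E x * max 0 (s' t))"
    proof -
      have "1 - P = 2 * (\<epsilon> * E x * s' t) - (\<epsilon> * E x * s' t)\<^sup>2 - (\<epsilon> * k * E x * s t)\<^sup>2"
        unfolding P by (simp add: power2_eq_square algebra_simps)
      also have "\<dots> \<le> 2 * (\<epsilon> * E x * s' t)" by simp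
      also have "\<dots> \<le> 2 * (\<epsilon> * E x * max 0 (s' t))"
        using \<epsilon> Epos[of x] by (intro mult_left_mono) auto
      finally show ?thesis .
    qed
    have P0: "P \<ge> 0" unfolding P_def by (simp add: sum_nonneg)
    have ux: "0 < u x" "u x \<le> 1 / 2" using u_pos[OF x(1)] half[OF xc _ \<delta>] x(2) by auto
    define F where "F = sqrt (2 * \<Phi> \<delta> (u x))"
    have F: "F \<ge> sqrt (\<mu> / 12)"
    proof -
      have "\<mu> / 6 * (1 / 2)\<^sup>2 \<le> \<mu> / 6 * (1 - u x)\<^sup>2"
        using ux \<mu> by (intro mult_left_mono power_mono) auto
      also have "\<dots> \<le> W (u x)" using W_lower[OF \<mu>(2), of "u x"] \<mu> ux by auto
      also have "\<dots> \<le> \<Phi> \<delta> (u x)" using \<delta> ux by (simp add: \<Phi>_def)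
      finally show ?thesis by (simp add: F_def power2_eq_square)
    qed
    have Fpos: "F > 0" using F \<mu> by (auto intro: less_le_trans[of 0 "sqrt (\<mu> / 12)"])
    have W'F: "- W' (u x) / F \<le> K" "W' (u x) \<le> 0"
    proof -
      have "- W' (u x) \<le> C * (1 - u x)" using C(2)[rule_format, of "u x"] ux by simp
      also have "\<dots> \<le> C * 1" using C ux by (intro mult_left_mono) auto
      finally show "- W' (u x) / F \<le> K" using F \<mu> C unfolding K_def by (intro frac_le) auto
      show "W' (u x) \<le> 0" using W'_nonpos[of "u x"] ux by simp
    qed
    have \<Phi>': "(\<Phi> \<delta> has_real_derivative W' (u x) - \<delta>) (at (u x))"
      unfolding \<Phi>_def using ux by (auto intro!: derivative_eq_intros W_deriv)
    have ev: "\<forall>\<^sub>F y in nhds x. 1 * (hodograph (\<Phi> \<delta>) (u y) - Q y) \<le> 1 * (hodograph (\<Phi> \<delta>) (u x) - Q x)"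
      using x(3) by (simp add: f_def)
    have "(W' (u x) - (W' (u x) - \<delta>) * P) / F \<le> - \<epsilon> * E x * (k\<^sup>2 * s t + s'' t)"
      using hodograph_touching[OF x(1) u_less_1[OF x(1)] \<Phi>c \<Phi>p\<delta>[OF \<delta>0] \<Phi>' sp _ ev]
      by (simp add: sumc P_def F_def)
    also have "\<dots> < - \<epsilon> * E x * (2 * K * max 0 (s' t))"
      using s(10)[OF t] \<epsilon> Epos[of x] by simp
    finally have 1: "(W' (u x) - (W' (u x) - \<delta>) * P) / F < - (K * (2 * (\<epsilon> * E x * max 0 (s' t))))"
      by (simp add: ac_simps)
    \<comment> \<open>Since W' <= 0, multiplying P1 by it reverses the inequality, and the extra
      term \<delta> P has the favourable sign. Together with the bound K this contradicts the strict
      inequality just obtained.\<close>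
    have "W' (u x) * (2 * (\<epsilon> * E x * max 0 (s' t))) \<le> W' (u x) * (1 - P)"
      using P1 W'F(2) by (rule mult_left_mono_neg)
    also have "\<dots> \<le> W' (u x) - (W' (u x) - \<delta>) * P" using P0 \<delta>0 by (simp add: algebra_simps)
    finally have "W' (u x) * (2 * (\<epsilon> * E x * max 0 (s' t))) / F \<le> (W' (u x) - (W' (u x) - \<delta>) * P) / F"
      using Fpos by (intro divide_right_mono) auto
    moreover have "- W' (u x) / F * (2 * (\<epsilon> * E x * max 0 (s' t))) \<le> K * (2 * (\<epsilon> * E x * max 0 (s' t)))"
      using W'F(1) \<epsilon> Epos[of x] by (intro mult_right_mono) auto
    ultimately show False using 1 by simp
  qed
  \<comment> \<open>Only the lower half of the slab is used, because s(t) >= A t holds just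
    there.\<close>
  have "hodograph (\<lambda>s. W s + \<delta> * (2 - s)) (u (y + t *\<^sub>R e)) \<le> (1 - \<epsilon> * E y * A) * t"
    if \<delta>: "\<delta> \<in> {0<..1}" and t: "t \<in> {0<..<\<tau> / 2}" and yt: "y + t *\<^sub>R e \<in> \<Omega>" for \<delta> t
  proof -
    have ee: "e \<bullet> e = 1" "e \<bullet> d = 0" using norm_e d by (auto simp: norm_eq_1 inner_commute)
    have "y + t *\<^sub>R e \<in> closure \<Omega>" "(y + t *\<^sub>R e) \<bullet> e \<le> m + \<tau>"
      using y yt t ee closure_subset by (auto simp: inner_add_left)
    from below[OF \<delta> this] have "hodograph (\<Phi> \<delta>) (u (y + t *\<^sub>R e)) \<le> t - \<epsilon> * (E y * s t)"
      using y ee by (simp add: Q_def E_def inner_add_left)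
    also have "\<dots> \<le> t - \<epsilon> * (E y * (A * t))"
      using s(9)[of t] t \<epsilon> Epos[of y] by (intro diff_left_mono mult_left_mono) auto
    finally show ?thesis by (simp add: \<Phi>_def algebra_simps)
  qed
  moreover have "\<epsilon> * E y * A > 0" "\<tau> / 2 > 0" using \<epsilon> Epos[of y] s(5) \<tau> by auto
  ultimately show ?thesis by blast
qed

end

section \<open>Slopes at the boundary\<close>

context positive_solution
begin

text \<open>u need not be differentiable at a boundary point. The mean value theorem along the
  segment expresses the quotient through \<open>G\<close> at an interior point, and \<open>G\<close>
  is continuous up to the closure.\<close>

lemma boundary_slope:
  assumes G: "C1_closure_grad \<Omega> u G" and y: "y \<in> frontier \<Omega>"
    and t0: "t0 > 0" "\<And>t. t \<in> {0<..<t0} \<Longrightarrow> y + t *\<^sub>R v \<in> \<Omega>"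
  shows "((\<lambda>t. u (y + t *\<^sub>R v) / t) \<longlongrightarrow> G y \<bullet> v) (at_right 0)"
proof -
  have yc: "y \<in> closure \<Omega>" using y by (simp add: frontier_def)
  have inc: "y + t *\<^sub>R v \<in> closure \<Omega>" if "t \<in> {0..<t0}" for t
    using that yc t0(2)[of t] closure_subset[of \<Omega>] by (cases "t = 0") auto
  have mvt: "\<exists>z\<in>{0<..<t}. u (y + t *\<^sub>R v) / t = G (y + z *\<^sub>R v) \<bullet> v" if t: "t \<in> {0<..<t0}" for t
  proof -
    have "\<exists>z\<in>{0<..<t}. u (y + t *\<^sub>R v) - u (y + 0 *\<^sub>R v) = (t - 0) *\<^sub>R v \<bullet> G (y + z *\<^sub>R v)"
    proof (rule mvt[of 0 t "\<lambda>r. u (y + r *\<^sub>R v)" "\<lambda>z h. h *\<^sub>R v \<bullet> G (y + z *\<^sub>R v)"])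
      show "continuous_on {0..t} (\<lambda>r. u (y + r *\<^sub>R v))"
        by (rule continuous_on_compose2[OF u_cont]) (use inc t in \<open>auto intro!: continuous_intros\<close>)
      fix z assume z: "0 < z" "z < t"
      have "GDERIV u (y + z *\<^sub>R v) :> G (y + z *\<^sub>R v)"
        using G t0(2)[of z] z t by (auto simp: C1_closure_grad_def)
      then have "(u has_derivative (\<lambda>h. h \<bullet> G (y + z *\<^sub>R v))) (at (y + z *\<^sub>R v))"
        by (simp add: gderiv_def)
      moreover have "((\<lambda>r. y + r *\<^sub>R v) has_derivative (\<lambda>h. h *\<^sub>R v)) (at z)"
        by (auto intro!: derivative_eq_intros)
      ultimately have "(u \<circ> (\<lambda>r. y + r *\<^sub>R v) has_derivative (\<lambda>h. h \<bullet> G (y + z *\<^sub>R v)) \<circ> (\<lambda>h. h *\<^sub>R v)) (at z)"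
        by (intro diff_chain_at)
      then show "((\<lambda>r. u (y + r *\<^sub>R v)) has_derivative (\<lambda>h. h *\<^sub>R v \<bullet> G (y + z *\<^sub>R v))) (at z)"
        by (simp add: o_def)
    qed (use t in auto)
    then show ?thesis using u_frontier[OF y] t by (auto simp: inner_commute field_simps)
  qed
  have line: "((\<lambda>t. y + t *\<^sub>R v) \<longlongrightarrow> y) (at_right 0)"
    using tendsto_add[OF tendsto_const[of y] tendsto_scaleR[OF tendsto_ident_at[of 0 "{0<..}"] tendsto_const[of v]]]
    by simp
  \<comment> \<open>The limit of \<open>G\<close> is taken along the punctured neighbourhood, so y +
    t v must differ from y; for v = 0 the convergence of \<open>G\<close> is trivial.\<close>
  have "filterlim (\<lambda>t. y + t *\<^sub>R v) (at y within closure \<Omega>) (at_right 0) \<or> v = 0"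
  proof (cases "v = 0")
    case False
    have "\<forall>\<^sub>F t in at_right 0. t \<in> {0<..<t0}" using t0(1) eventually_at_right_real[OF t0(1)] by simp
    then have "\<forall>\<^sub>F t in at_right 0. y + t *\<^sub>R v \<in> closure \<Omega> \<and> y + t *\<^sub>R v \<noteq> y"
      by eventually_elim (use inc False in auto)
    then show ?thesis using line by (simp add: filterlim_at)
  qed simp
  moreover have "(G \<longlongrightarrow> G y) (at y within closure \<Omega>)"
    using G yc by (simp add: C1_closure_grad_def continuous_on_def)
  ultimately have "((\<lambda>t. G (y + t *\<^sub>R v)) \<longlongrightarrow> G y) (at_right 0)"
    by (auto intro: filterlim_compose)
  then have lim: "((\<lambda>t. G (y + t *\<^sub>R v) \<bullet> v) \<longlongrightarrow> G y \<bullet> v) (at_right 0)"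
    by (intro tendsto_intros)
  show ?thesis
  proof (rule tendstoI)
    fix r :: real assume "r > 0"
    then have "\<forall>\<^sub>F t in at_right 0. dist (G (y + t *\<^sub>R v) \<bullet> v) (G y \<bullet> v) < r"
      using lim by (rule tendstoD[rotated])
    then obtain b where b: "b > 0" "\<And>t. t > 0 \<Longrightarrow> t < b \<Longrightarrow> dist (G (y + t *\<^sub>R v) \<bullet> v) (G y \<bullet> v) < r"
      unfolding eventually_at_right_field by auto
    have "dist (u (y + t *\<^sub>R v) / t) (G y \<bullet> v) < r" if "0 < t" "t < min b t0" for t
    proof -
      have "t \<in> {0<..<t0}" using that by simp
      from mvt[OF this] obtain z where
        z: "z \<in> {0<..<t}" "u (y + t *\<^sub>R v) / t = G (y + z *\<^sub>R v) \<bullet> v" by blast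
      show ?thesis unfolding z(2) using b(2)[of z] z(1) that by auto
    qed
    then show "\<forall>\<^sub>F t in at_right 0. dist (u (y + t *\<^sub>R v) / t) (G y \<bullet> v) < r"
      unfolding eventually_at_right_field using b(1) t0(1) by (intro exI[of _ "min b t0"]) auto
  qed
qed

text \<open>T(u)/t is T(u)/u times u/t. The first factor tends to T'(0) because u tends to 0 through
  positive values along the segment.\<close>

lemma hodograph_boundary_slope:
  assumes G: "C1_closure_grad \<Omega> u G" and y: "y \<in> frontier \<Omega>"
    and t0: "t0 > 0" "\<And>t. t \<in> {0<..<t0} \<Longrightarrow> y + t *\<^sub>R v \<in> \<Omega>"
    and \<Phi>: "continuous_on {0..b} \<Phi>" "\<And>s. s \<in> {0..b} \<Longrightarrow> \<Phi> s > 0" "b > 0"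
  shows "((\<lambda>t. hodograph \<Phi> (u (y + t *\<^sub>R v)) / t) \<longlongrightarrow> G y \<bullet> v / sqrt (2 * \<Phi> 0)) (at_right 0)"
proof -
  note slope = boundary_slope[OF G y t0]
  have "((\<lambda>s. (hodograph \<Phi> s - hodograph \<Phi> 0) / (s - 0)) \<longlongrightarrow> 1 / sqrt (2 * \<Phi> 0)) (at 0 within {0..b})"
    using hodograph_deriv_within[OF \<Phi>(1,2), of 0] \<Phi>(3) by (simp add: has_field_derivative_iff)
  then have q: "((\<lambda>s. hodograph \<Phi> s / s) \<longlongrightarrow> 1 / sqrt (2 * \<Phi> 0)) (at 0 within {0..b})"
    by (simp add: hodograph_0)
  have evt: "\<forall>\<^sub>F t in at_right 0. t \<in> {0<..<t0}" using eventually_at_right_real[OF t0(1)] by simp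
  have "((\<lambda>t. u (y + t *\<^sub>R v) / t * t) \<longlongrightarrow> G y \<bullet> v * 0) (at_right 0)"
    by (intro tendsto_mult slope tendsto_ident_at)
  moreover have "\<forall>\<^sub>F t in at_right 0. u (y + t *\<^sub>R v) / t * t = u (y + t *\<^sub>R v)"
    using evt by eventually_elim auto
  ultimately have u0: "((\<lambda>t. u (y + t *\<^sub>R v)) \<longlongrightarrow> 0) (at_right 0)"
    by (subst (asm) tendsto_cong) simp_all
  have "\<forall>\<^sub>F t in at_right 0. u (y + t *\<^sub>R v) \<in> {0..b} \<and> u (y + t *\<^sub>R v) \<noteq> 0"
    using evt order_tendstoD(2)[OF u0 \<Phi>(3)]
  proof eventually_elim
    case (elim t) then show ?case using u_pos[OF t0(2)[OF elim(1)]] by auto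
  qed
  then have "filterlim (\<lambda>t. u (y + t *\<^sub>R v)) (at 0 within {0..b}) (at_right 0)"
    using u0 by (simp add: filterlim_at)
  from tendsto_mult[OF filterlim_compose[OF q this] slope]
  have "((\<lambda>t. hodograph \<Phi> (u (y + t *\<^sub>R v)) / u (y + t *\<^sub>R v) * (u (y + t *\<^sub>R v) / t))
      \<longlongrightarrow> G y \<bullet> v / sqrt (2 * \<Phi> 0)) (at_right 0)"
    by simp
  moreover have "\<forall>\<^sub>F t in at_right 0. hodograph \<Phi> (u (y + t *\<^sub>R v)) / u (y + t *\<^sub>R v) * (u (y + t *\<^sub>R v) / t)
      = hodograph \<Phi> (u (y + t *\<^sub>R v)) / t"
    using evt
  proof eventually_elim
    case (elim t) then show ?case using u_pos[OF t0(2)[OF elim]] by auto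
  qed
  ultimately show ?thesis by (subst (asm) tendsto_cong) simp_all
qed

end

section \<open>Upper and lower bounds for the normal derivative\<close>

context slab_solution
begin

text \<open>Dividing the strict comparison by t bounds the slope by (1 - \<eta>) sqrt (2 (W(0) + 2
  \<delta>)). Since \<eta> does not depend on \<delta>, letting \<delta> -> 0 leaves a factor below
  1, and W(0) > 0 makes the inequality strict.\<close>

lemma slope_upper:
  assumes G: "C1_closure_grad \<Omega> u G" and y: "y \<in> frontier \<Omega>" "y \<bullet> e = m"
    and t0: "t0 > 0" "\<And>t. t \<in> {0<..<t0} \<Longrightarrow> y + t *\<^sub>R e \<in> \<Omega>"
    and d: "norm d = 1" "d \<bullet> e = 0"
  shows "G y \<bullet> e < sqrt (2 * W 0)"
proof -
  obtain \<tau> \<eta> where \<tau>: "\<tau> > 0" and \<eta>: "\<eta> > 0"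
    "\<forall>\<delta>\<in>{0<..1}. \<forall>t\<in>{0<..<\<tau>}. y + t *\<^sub>R e \<in> \<Omega> \<longrightarrow>
       hodograph (\<lambda>s. W s + \<delta> * (2 - s)) (u (y + t *\<^sub>R e)) \<le> (1 - \<eta>) * t"
    using hodograph_strictly_below_height[OF d y(2)] by blast
  have bound: "G y \<bullet> e \<le> (1 - \<eta>) * sqrt (2 * (W 0 + \<delta> * 2))" if \<delta>: "\<delta> \<in> {0<..1}" for \<delta>
  proof -
    let ?\<Phi> = "\<lambda>s. W s + \<delta> * (2 - s)"
    have \<Phi>c: "continuous_on {0..1} ?\<Phi>"
      by (intro continuous_intros continuous_on_subset[OF W_cont]) auto
    have \<Phi>p: "?\<Phi> s > 0" if "s \<in> {0..1}" for s
      using that W_nonneg[of s] \<delta> by (intro add_nonneg_pos) auto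
    have "G y \<bullet> e / sqrt (2 * ?\<Phi> 0) \<le> 1 - \<eta>"
    proof (rule tendsto_upperbound[OF hodograph_boundary_slope[OF G y(1) t0 \<Phi>c \<Phi>p]])
      have "\<forall>\<^sub>F t in at_right 0. t \<in> {0<..<min t0 \<tau>}"
        using eventually_at_right_real[of 0 "min t0 \<tau>"] t0(1) \<tau> by simp
      then show "\<forall>\<^sub>F t in at_right 0. hodograph ?\<Phi> (u (y + t *\<^sub>R e)) / t \<le> 1 - \<eta>"
        by eventually_elim (use \<eta>(2) \<delta> t0(2) in \<open>auto simp: divide_le_eq\<close>)
    qed auto
    moreover have "sqrt (2 * ?\<Phi> 0) > 0" using \<Phi>p[of 0] by simp
    ultimately show ?thesis by (simp add: divide_le_eq)
  qed
  have "((\<lambda>\<delta>. (1 - \<eta>) * sqrt (2 * (W 0 + \<delta> * 2))) \<longlongrightarrow> (1 - \<eta>) * sqrt (2 * (W 0 + 0 * 2))) (at_right 0)"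
    by (intro tendsto_intros)
  moreover have "\<forall>\<^sub>F \<delta> in at_right 0. G y \<bullet> e \<le> (1 - \<eta>) * sqrt (2 * (W 0 + \<delta> * 2))"
  proof -
    have "\<forall>\<^sub>F \<delta> in at_right 0. \<delta> \<in> {0<..<1::real}" by (rule eventually_at_right_real) simp
    then show ?thesis by eventually_elim (rule bound, auto)
  qed
  ultimately have "G y \<bullet> e \<le> (1 - \<eta>) * sqrt (2 * (W 0 + 0 * 2))"
    by (rule tendsto_lowerbound) simp
  also have "\<dots> < sqrt (2 * W 0)" using \<eta>(1) W_pos[of 0] by (simp add: algebra_simps)
  finally show ?thesis .
qed

text \<open>The comparison function \<zeta> in the ball has slope 1 at the sphere, |grad \<zeta>|^2
  = M = |x - p|^2 / R^2 and Laplacian - n / R. Contact with T(u) would give (1 - M) (- W'(u)) + a M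
  (1 - u) <= (n / R) sqrt (2 \<Phi>(u)). All terms are compared with multiples of 1 - u, and the
  right side is small for large R. The radius is fixed before the ball, so any ball of this radius
  touching from inside may be used.\<close>

lemma slope_lower:
  assumes G: "C1_closure_grad \<Omega> u G" and a0: "a0 > 0"
  obtains R where "R > 0"
    "\<And>p y. ball p R \<subseteq> \<Omega> \<Longrightarrow> y \<in> frontier \<Omega> \<Longrightarrow> dist p y = R \<Longrightarrow>
       sqrt (2 * W 0 - a0) \<le> G y \<bullet> ((p - y) /\<^sub>R R)"
proof -
  obtain \<mu> where \<mu>: "\<mu> > 0" "\<forall>s\<in>{0<..<1}. W' s \<le> - \<mu> * s * (1 - s)" using W'_upper by blast
  obtain C where C: "C > 0" "\<forall>s\<in>{0<..1}. - C * (1 - s) \<le> W' s" using W'_lower by blast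
  obtain r0 where r0: "r0 > 0" "\<And>r p. r \<ge> r0 \<Longrightarrow> cball p r \<subseteq> \<Omega> \<Longrightarrow> u p \<ge> 1 / 2"
    using u_ge_half_deep by blast
  \<comment> \<open>The bound \<mu>/6 makes \<Phi> positive below 1 by \<open>W_lower\<close>, and
    it is small enough for - W' to win near the centre.\<close>
  define a where "a = min a0 (\<mu> / 6)"
  have a: "a > 0" "a \<le> a0" "a \<le> \<mu> / 6" using a0 \<mu> by (auto simp: a_def)
  define n where "n = real DIM('a)"
  define L where "L = n * sqrt (2 * C)"
  \<comment> \<open>The first entry lets balls of radius R/4 qualify for the bound u >= 1/2; the
    second makes L / R < a / 2.\<close>
  define R where "R = max (4 * r0) (2 * L / a + 1)"
  have R: "R > 0" "R / 4 \<ge> r0" using r0 by (auto simp: R_def)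
  have "2 * L / a < R" by (simp add: R_def)
  then have LR: "L / R < a / 2" using a R by (simp add: field_simps)
  \<comment> \<open>Here \<Phi>' = W' + a (1 - s), a perturbation of the sign opposite to that in
    the upper comparison. The quadratic factor matches the vanishing of W at 1.\<close>
  define \<Phi> where "\<Phi> = (\<lambda>s. W s - a / 2 * (1 - s)\<^sup>2)"
  have \<Phi>c: "continuous_on {0..b} \<Phi>" for b
    unfolding \<Phi>_def by (intro continuous_intros continuous_on_subset[OF W_cont]) auto
  have \<Phi>p: "\<Phi> s > 0" if "s \<in> {0..b}" "b < 1" for s b
  proof -
    have "a / 2 * (1 - s)\<^sup>2 < \<mu> / 6 * (1 - s)\<^sup>2"
      using a \<mu> that by (intro mult_strict_right_mono) auto
    also have "\<dots> \<le> W s" using W_lower[OF \<mu>(2), of s] \<mu> that by auto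
    finally show ?thesis by (simp add: \<Phi>_def)
  qed
  have "sqrt (2 * W 0 - a0) \<le> G y \<bullet> ((p - y) /\<^sub>R R)"
    if sub: "ball p R \<subseteq> \<Omega>" and y: "y \<in> frontier \<Omega>" "dist p y = R" for p y
  proof -
    define \<zeta> where "\<zeta> = (\<lambda>x. (R\<^sup>2 - (norm (x - p))\<^sup>2) / (2 * R))"
    have subc: "cball p R \<subseteq> closure \<Omega>"
      using closure_mono[OF sub] R by simp
    have uc: "continuous_on (cball p R) u" by (rule continuous_on_subset[OF u_cont subc])
    obtain q where q: "q \<in> cball p R" "\<And>x. x \<in> cball p R \<Longrightarrow> u x \<le> u q"
      using continuous_attains_sup[OF compact_cball _ uc] R by (metis cball_eq_empty less_le_not_le)
    \<comment> \<open>\<Phi> vanishes at 1, so T is used only up to a level strictly between the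
      maximum of u on the closed ball and 1.\<close>
    define b where "b = (1 + u q) / 2"
    have uq: "0 \<le> u q" "u q < 1" using u_less_1_closure[of q] u_nonneg[of q] q(1) subc by auto
    then have b: "0 < b" "b < 1" "u q < b" by (auto simp: b_def)
    have ub: "u x \<in> {0..b}" "u x < b" if "x \<in> cball p R" for x
      using q(2)[OF that] b u_nonneg[of x] that subc by auto
    have above: "\<zeta> x0 \<le> hodograph \<Phi> (u x0)" if x0: "x0 \<in> cball p R" for x0
    proof (rule ccontr)
      assume contr: "\<not> \<zeta> x0 \<le> hodograph \<Phi> (u x0)"
      define f where "f = (\<lambda>x. \<zeta> x - hodograph \<Phi> (u x))"
      have "continuous_on (cball p R) (\<lambda>x. hodograph \<Phi> (u x))"
        by (rule continuous_on_compose2[OF hodograph_continuous_on[OF \<Phi>c \<Phi>p[OF _ b(2)]] uc])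
           (use ub in auto)
      then have "continuous_on (cball p R) f"
        unfolding f_def \<zeta>_def using R by (intro continuous_intros) auto
      then obtain x where x: "x \<in> cball p R" "\<And>z. z \<in> cball p R \<Longrightarrow> f z \<le> f x"
        using continuous_attains_sup[OF compact_cball, of p R f] x0 by blast
      have fx: "f x > 0" using contr x(2)[OF x0] by (simp add: f_def)
      have T: "hodograph \<Phi> (u x) \<ge> 0"
        using hodograph_nonneg[OF \<Phi>c \<Phi>p[OF _ b(2)], of "u x"] ub[OF x(1)] by auto
      then have "\<zeta> x > 0" using fx by (simp add: f_def)
      then have "(norm (x - p))\<^sup>2 < R\<^sup>2" using R by (simp add: \<zeta>_def zero_less_divide_iff)
      then have nx: "norm (x - p) < R" using R by (simp add: power2_less_imp_less)
      then have xb: "x \<in> ball p R" by (simp add: dist_norm norm_minus_commute)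
      then have xO: "x \<in> \<Omega>" using sub by blast
      have ux: "0 < u x" "u x < 1" using u_pos u_less_1 xO by auto
      define M where "M = (norm (x - p))\<^sup>2 / R\<^sup>2"
      have M: "0 \<le> M" "M < 1" using \<open>(norm (x - p))\<^sup>2 < R\<^sup>2\<close> R by (auto simp: M_def)
      have sp: "second_partials \<zeta> x (\<lambda>i. (1 / (2 * R)) * (0 - 2 * ((x - p) \<bullet> i))) (\<lambda>i. (1 / (2 * R)) * (0 - 2))"
      proof -
        have "\<zeta> = (\<lambda>y. (1 / (2 * R)) * (R\<^sup>2 - (norm (y - p))\<^sup>2))" by (auto simp: \<zeta>_def)
        then show ?thesis
          by (simp only:) (intro second_partials_cmult second_partials_diff second_partials_const
              second_partials_norm_square)
      qed
      have "\<forall>\<^sub>F z in nhds x. z \<in> ball p R" using xb by (intro eventually_nhds_in_open) auto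
      then have ev: "\<forall>\<^sub>F z in nhds x. -1 * (hodograph \<Phi> (u z) - \<zeta> z) \<le> -1 * (hodograph \<Phi> (u x) - \<zeta> x)"
        by eventually_elim (use x(2) in \<open>auto simp: f_def\<close>)
      have \<Phi>': "(\<Phi> has_real_derivative W' (u x) + a * (1 - u x)) (at (u x))"
        unfolding \<Phi>_def using ux by (auto intro!: derivative_eq_intros W_deriv simp: field_simps)
      have sa: "(\<Sum>i\<in>Basis. ((1 / (2 * R)) * (0 - 2 * ((x - p) \<bullet> i)))\<^sup>2) = M"
        using sum_inner_Basis_square[of "x - p"] R
        by (simp add: M_def power_divide sum_divide_distrib[symmetric])
      have sc: "(\<Sum>i\<in>(Basis::'a set). (1 / (2 * R)) * (0 - 2)) = - (n / R)" by (simp add: n_def)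
      define F where "F = sqrt (2 * \<Phi> (u x))"
      have \<Phi>x: "\<Phi> (u x) > 0" using \<Phi>p[of "u x" b] ub[OF x(1)] b by auto
      have F: "0 < F" using \<Phi>x by (simp add: F_def)
      have "- (n / R) \<le> (W' (u x) - (W' (u x) + a * (1 - u x)) * M) / F"
        using hodograph_touching[OF xO ub(2)[OF x(1)] \<Phi>c \<Phi>p[OF _ b(2)] \<Phi>' sp _ ev]
        unfolding sa sc F_def by linarith
      then have 1: "(1 - M) * (- W' (u x)) + a * M * (1 - u x) \<le> n / R * F"
        using F by (simp add: pos_le_divide_eq algebra_simps)
      have "\<Phi> (u x) \<le> W (u x)" using a by (simp add: \<Phi>_def)
      also have "\<dots> \<le> C * (1 - u x)\<^sup>2" using W_upper[OF C(2,1)] ux by auto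
      finally have "F \<le> sqrt (2 * C * (1 - u x)\<^sup>2)" by (simp add: F_def)
      also have "\<dots> = sqrt (2 * C) * (1 - u x)" using ux by (simp add: real_sqrt_mult)
      finally have "n / R * F \<le> n / R * (sqrt (2 * C) * (1 - u x))"
        using R by (intro mult_left_mono) (auto simp: n_def)
      also have "\<dots> = L / R * (1 - u x)" by (simp add: L_def)
      also have "\<dots> < a / 2 * (1 - u x)" using LR ux by (intro mult_strict_right_mono) auto
      finally have 2: "(1 - M) * (- W' (u x)) + a * M * (1 - u x) < a / 2 * (1 - u x)" using 1 by linarith
      \<comment> \<open>For M >= 1/2 the perturbation a M (1 - u) alone suffices. For M < 1/2 the
        point x is within 3R/4 of the centre, so a ball of radius R/4 around it fits into \<Omega>;
        then u >= 1/2 and - W'(u) >= (\<mu>/2) (1 - u).\<close>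
      show False
      proof (cases "M \<ge> 1 / 2")
        case True
        have "0 \<le> (1 - M) * (- W' (u x))"
          using M W'_nonpos[of "u x"] ux by (intro mult_nonneg_nonneg) auto
        moreover have "a / 2 * (1 - u x) \<le> a * M * (1 - u x)"
          using True a ux by (intro mult_right_mono) auto
        ultimately show False using 2 by simp
      next
        case False
        have "(norm (x - p))\<^sup>2 < 1 / 2 * R\<^sup>2" using False R by (simp add: M_def field_simps)
        moreover have "(3 / 4 * R)\<^sup>2 = 9 / 16 * R\<^sup>2" by (simp add: power_mult_distrib power_divide)
        moreover have "R\<^sup>2 > 0" using R by simp
        ultimately have "(norm (x - p))\<^sup>2 < (3 / 4 * R)\<^sup>2" by linarith
        then have "norm (x - p) < 3 / 4 * R" by (rule power2_less_imp_less) (use R in simp)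
        then have "dist p x < 3 / 4 * R" by (simp only: dist_norm norm_minus_commute)
        have "cball x (R / 4) \<subseteq> ball p R"
        proof
          fix z assume "z \<in> cball x (R / 4)"
          then show "z \<in> ball p R" using dist_triangle[of p z x] \<open>dist p x < 3 / 4 * R\<close> by simp
        qed
        then have u2: "u x \<ge> 1 / 2" using r0(2)[OF R(2), of x] sub by auto
        have "\<mu> / 2 * (1 - u x) \<le> \<mu> * u x * (1 - u x)"
          using u2 \<mu> ux by (intro mult_right_mono) auto
        then have "\<mu> / 2 * (1 - u x) \<le> - W' (u x)" using \<mu>(2)[rule_format, of "u x"] ux by simp
        moreover have "1 / 2 * (- W' (u x)) \<le> (1 - M) * (- W' (u x))"
          using False W'_nonpos[of "u x"] ux by (intro mult_right_mono) auto
        moreover have "a / 2 * (1 - u x) \<le> \<mu> / 4 * (1 - u x)"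
          using a \<mu> ux by (intro mult_right_mono) auto
        moreover have "0 \<le> a * M * (1 - u x)" using a M ux by simp
        ultimately show False using 2 by linarith
      qed
    qed
    let ?v = "(p - y) /\<^sub>R R"
    have line: "norm (y + t *\<^sub>R ?v - p) = R - t" if "t \<in> {0<..<R}" for t
    proof -
      have "y + t *\<^sub>R ?v - p = (1 - t / R) *\<^sub>R (y - p)"
        by (simp add: algebra_simps divide_inverse)
      moreover have "norm (y - p) = R" using y(2) by (simp only: dist_norm norm_minus_commute)
      moreover have "0 \<le> 1 - t / R" using that R by simp
      ultimately have "norm (y + t *\<^sub>R ?v - p) = (1 - t / R) * R" by (simp only: norm_scaleR abs_of_nonneg)
      also have "\<dots> = R - t" using R by (simp add: algebra_simps)
      finally show ?thesis .
    qed
    have inO: "y + t *\<^sub>R ?v \<in> \<Omega>" if "t \<in> {0<..<R}" for t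
      using line[OF that] that sub by (auto simp: dist_norm norm_minus_commute)
    have lb: "1 - t / (2 * R) \<le> hodograph \<Phi> (u (y + t *\<^sub>R ?v)) / t" if t: "t \<in> {0<..<R}" for t
    proof -
      have "y + t *\<^sub>R ?v \<in> cball p R" using line[OF t] t by (auto simp: dist_norm norm_minus_commute)
      from above[OF this] have "(R\<^sup>2 - (R - t)\<^sup>2) / (2 * R) \<le> hodograph \<Phi> (u (y + t *\<^sub>R ?v))"
        unfolding \<zeta>_def line[OF t] .
      moreover have "(R\<^sup>2 - (R - t)\<^sup>2) / (2 * R) = (1 - t / (2 * R)) * t"
        using R by (simp add: field_simps power2_eq_square)
      ultimately show ?thesis using t by (simp add: le_divide_eq)
    qed
    have "1 - 0 / (2 * R) \<le> G y \<bullet> ?v / sqrt (2 * \<Phi> 0)"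
    proof (rule tendsto_le[OF _ hodograph_boundary_slope[OF G y(1) R(1) inO \<Phi>c \<Phi>p[OF _ b(2)] b(1)]])
      show "((\<lambda>t. 1 - t / (2 * R)) \<longlongrightarrow> 1 - 0 / (2 * R)) (at_right 0)"
        using R by (intro tendsto_intros) auto
      show "\<forall>\<^sub>F t in at_right 0. 1 - t / (2 * R) \<le> hodograph \<Phi> (u (y + t *\<^sub>R ?v)) / t"
        using eventually_at_right_real[OF R(1)] by eventually_elim (use lb in auto)
    qed auto
    moreover have "sqrt (2 * \<Phi> 0) > 0" using \<Phi>p[of 0 b] b by simp
    ultimately have "sqrt (2 * \<Phi> 0) \<le> G y \<bullet> ?v" by (simp add: le_divide_eq)
    moreover have "sqrt (2 * W 0 - a0) \<le> sqrt (2 * \<Phi> 0)" using a by (simp add: \<Phi>_def)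
    ultimately show ?thesis by linarith
  qed
  with R(1) show thesis using that by blast
qed

end

section \<open>Epigraphs\<close>

context
  fixes \<phi> :: "'a::euclidean_space \<Rightarrow> real"
  assumes cont: "continuous_on UNIV \<phi>"
begin

lemma open_epigraph: "open (epigraph_domain \<phi>)"
proof -
  have "open {p :: 'a \<times> real. \<phi> (fst p) < snd p}"
    by (intro open_Collect_less continuous_on_compose2[OF cont] continuous_intros) auto
  then show ?thesis by (simp add: epigraph_domain_def case_prod_beta')
qed

lemma closure_epigraph: "closure (epigraph_domain \<phi>) = {p. \<phi> (fst p) \<le> snd p}"
proof
  have "closed {p :: 'a \<times> real. \<phi> (fst p) \<le> snd p}"
    by (intro closed_Collect_le continuous_on_compose2[OF cont] continuous_intros) auto
  then show "closure (epigraph_domain \<phi>) \<subseteq> {p. \<phi> (fst p) \<le> snd p}"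
    by (intro closure_minimal) (auto simp: epigraph_domain_def)
  show "{p. \<phi> (fst p) \<le> snd p} \<subseteq> closure (epigraph_domain \<phi>)"
  proof
    fix p :: "'a \<times> real" assume p: "p \<in> {p. \<phi> (fst p) \<le> snd p}"
    show "p \<in> closure (epigraph_domain \<phi>)"
      unfolding closure_approachable
    proof (intro allI impI)
      fix r :: real assume "r > 0"
      then have "(fst p, snd p + r / 2) \<in> epigraph_domain \<phi>" "dist (fst p, snd p + r / 2) p < r"
        using p by (auto simp: epigraph_domain_def dist_prod_def dist_real_def)
      then show "\<exists>y\<in>epigraph_domain \<phi>. dist y p < r" by blast
    qed
  qed
qed

lemma frontier_epigraph: "frontier (epigraph_domain \<phi>) = {p. \<phi> (fst p) = snd p}"
  unfolding frontier_def interior_open[OF open_epigraph] closure_epigraph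
  by (auto simp: epigraph_domain_def)

text \<open>The centre moves up the axis over 0 until its distance to the boundary is exactly R, by
  the intermediate value theorem. The resulting ball meets \<Omega> but not its frontier, so by
  connectedness it lies in \<Omega>.\<close>

lemma touching_ball:
  assumes R: "R > 0"
  obtains p y where "ball p R \<subseteq> epigraph_domain \<phi>" "y \<in> frontier (epigraph_domain \<phi>)" "dist p y = R"
proof -
  let ?F = "frontier (epigraph_domain \<phi>)"
  define h where "h = (\<lambda>t. infdist (0 :: 'a, t) ?F)"
  have base: "(0, \<phi> 0) \<in> ?F" by (simp add: frontier_epigraph)
  obtain M where M: "\<And>x. x \<in> cball 0 R \<Longrightarrow> \<phi> x \<le> M"
    using continuous_attains_sup[OF compact_cball _ continuous_on_subset[OF cont subset_UNIV], of 0 R] R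
    by (metis cball_eq_empty less_le_not_le)
  \<comment> \<open>A boundary point nearer than R would lie over \<open>cball 0 R\<close> and yet
    above the bound M of \<phi> on that ball.\<close>
  have far: "R \<le> h (M + R)"
  proof (rule ccontr)
    assume c: "\<not> R \<le> h (M + R)"
    obtain q where q: "q \<in> ?F" "h (M + R) = dist (0, M + R) q"
      using infdist_attains_inf[of ?F "(0, M + R)"] base by (auto simp: h_def)
    then have "dist 0 (fst q) < R" "dist (M + R) (snd q) < R"
      using c dist_fst_le[of "(0, M + R)" q] dist_snd_le[of "(0, M + R)" q] by auto
    then have "\<phi> (fst q) \<le> M" "snd q > M" using M[of "fst q"] by (auto simp: dist_real_def)
    then show False using q(1) by (simp add: frontier_epigraph)
  qed
  have "h (\<phi> 0) = 0" using base by (simp add: h_def)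
  moreover have "\<phi> 0 \<le> M + R" using M[of 0] R by simp
  moreover have "continuous_on {\<phi> 0..M + R} h"
    unfolding h_def by (intro continuous_intros)
  ultimately obtain t where t: "\<phi> 0 \<le> t" "h t = R" using IVT'[of h "\<phi> 0" R "M + R"] far R by auto
  define p where "p = (0 :: 'a, t)"
  have "t \<noteq> \<phi> 0" using \<open>h (\<phi> 0) = 0\<close> t R by auto
  then have pO: "p \<in> epigraph_domain \<phi>" using t by (simp add: p_def epigraph_domain_def)
  have inf: "infdist p ?F = R" using t by (simp add: h_def p_def)
  obtain y where y: "y \<in> ?F" "infdist p ?F = dist p y"
    using infdist_attains_inf[of ?F p] base by auto
  have "ball p R \<inter> ?F = {}" using infdist_le[of _ ?F p] inf by force
  moreover have "p \<in> ball p R \<inter> epigraph_domain \<phi>" using pO R by simp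
  then have "ball p R \<inter> epigraph_domain \<phi> \<noteq> {}" by blast
  ultimately have "ball p R - epigraph_domain \<phi> = {}"
    using connected_Int_frontier[of "ball p R" "epigraph_domain \<phi>"] by auto
  then have "ball p R \<subseteq> epigraph_domain \<phi>" by (simp only: Diff_eq_empty_iff)
  with y inf that show thesis by auto
qed

end

section \<open>Outer normals of the epigraph\<close>

lemma gradient_exists:
  fixes f :: "'a::euclidean_space \<Rightarrow> real"
  assumes "f differentiable (at x)"
  obtains w where "GDERIV f x :> w"
proof -
  obtain D where D: "(f has_derivative D) (at x)" using assms by (auto simp: differentiable_def)
  have "D = (\<lambda>h. h \<bullet> (\<Sum>i\<in>Basis. D i *\<^sub>R i))"
  proof
    fix h
    have "D h = D (\<Sum>i\<in>Basis. (h \<bullet> i) *\<^sub>R i)" by (simp add: euclidean_representation)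
    also have "\<dots> = (\<Sum>i\<in>Basis. (h \<bullet> i) * D i)"
      using has_derivative_bounded_linear[OF D] by (simp add: linear_simps linear_sum bounded_linear.linear linear_cmul)
    finally show "D h = h \<bullet> (\<Sum>i\<in>Basis. D i *\<^sub>R i)" by (simp add: inner_sum_right mult.commute)
  qed
  with D have "GDERIV f x :> (\<Sum>i\<in>Basis. D i *\<^sub>R i)" by (simp add: gderiv_def)
  then show thesis using that by blast
qed

context
  fixes \<phi> :: "'a::euclidean_space \<Rightarrow> real"
  assumes C1: "Ck_on 1 UNIV \<phi>"
begin

lemma C1_differentiable: "\<phi> differentiable (at x)"
  using C1 by simp

lemma C1_continuous: "continuous_on UNIV \<phi>"
  using C1_differentiable
  by (simp add: continuous_on_eq_continuous_at differentiable_imp_continuous_within)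

lemma height_has_derivative:
  "((\<lambda>p. \<phi> (fst p) - snd p) has_derivative (\<lambda>h. frechet_derivative \<phi> (at (fst p)) (fst h) - snd h)) (at p)"
proof -
  have "(\<phi> has_derivative frechet_derivative \<phi> (at (fst p))) (at (fst p))"
    using C1_differentiable frechet_derivative_works by blast
  from diff_chain_at[OF has_derivative_fst[OF has_derivative_ident] this]
  have "((\<lambda>p. \<phi> (fst p)) has_derivative (\<lambda>h. frechet_derivative \<phi> (at (fst p)) (fst h))) (at p)"
    by (simp add: o_def)
  then show ?thesis by (auto intro!: derivative_eq_intros)
qed

lemma height_GDERIV:
  assumes "GDERIV \<phi> (fst p) :> w"
  shows "GDERIV (\<lambda>p. \<phi> (fst p) - snd p) p :> (w, - 1)"
proof -
  have "frechet_derivative \<phi> (at (fst p)) = (\<lambda>h. h \<bullet> w)"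
    using assms frechet_derivative_at unfolding gderiv_def by metis
  with height_has_derivative[of p] show ?thesis
    by (simp add: gderiv_def inner_prod_def)
qed

text \<open>The difference of \<phi> and the height is a defining function on the whole space with
  gradient (w, -1), which never vanishes. The boundary condition ranges over all outer normals, so
  exhibiting this one is enough to use it.\<close>

lemma epigraph_normal:
  assumes y: "y \<in> frontier (epigraph_domain \<phi>)" and w: "GDERIV \<phi> (fst y) :> w"
  shows "outer_unit_normal (epigraph_domain \<phi>) y ((w, - 1) /\<^sub>R norm (w, - 1 :: real))"
  unfolding outer_unit_normal_def
proof (intro conjI y exI[of _ UNIV] exI[of _ "\<lambda>p. \<phi> (fst p) - snd p"] exI[of _ "(w, - 1)"])
  have fd: "frechet_derivative (\<lambda>p. \<phi> (fst p) - snd p) (at p) =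
      (\<lambda>h. frechet_derivative \<phi> (at (fst p)) (fst h) - snd h)" for p
    using frechet_derivative_at[OF height_has_derivative] by metis
  have "continuous_on UNIV (\<lambda>x. frechet_derivative \<phi> (at x) v)" for v
    using C1 by simp
  then have "continuous_on UNIV (\<lambda>p :: 'a \<times> real. frechet_derivative \<phi> (at (fst p)) v)" for v
    by (rule continuous_on_compose2) (auto intro: continuous_intros)
  then show "Ck_on 1 UNIV (\<lambda>p. \<phi> (fst p) - snd p)"
    using height_has_derivative by (auto simp: fd differentiable_def intro!: continuous_intros)
  show "GDERIV (\<lambda>p. \<phi> (fst p) - snd p) y :> (w, - 1)" by (rule height_GDERIV[OF w])
qed (auto simp: epigraph_domain_def zero_prod_def)

text \<open>The defining function is nonpositive on the closed ball and 0 at y, so its gradient g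
  satisfies g . (q - y) <= 0 on the ball. For a ball this forces g to be a positive multiple of y -
  p.\<close>

lemma touching_ball_normal:
  assumes sub: "ball p R \<subseteq> epigraph_domain \<phi>" and R: "R > 0"
    and y: "y \<in> frontier (epigraph_domain \<phi>)" "dist p y = R"
    and w: "GDERIV \<phi> (fst y) :> w"
  shows "(w, - 1) /\<^sub>R norm (w, - 1 :: real) = (y - p) /\<^sub>R R"
proof -
  let ?\<rho> = "\<lambda>p. \<phi> (fst p) - snd p"
  define g where "g = (w, - 1 :: real)"
  have gnz: "norm g > 0" by (simp add: g_def zero_prod_def)
  have \<rho>y: "?\<rho> y = 0" using y(1) frontier_epigraph[OF C1_continuous] by simp
  have "cball p R \<subseteq> closure (epigraph_domain \<phi>)" using closure_mono[OF sub] R by simp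
  then have \<rho>: "?\<rho> q \<le> 0" if "q \<in> cball p R" for q
    using that closure_epigraph[OF C1_continuous] by auto
  have first_order: "g \<bullet> (q - y) \<le> 0" if q: "q \<in> cball p R" for q
  proof (rule ccontr)
    assume "\<not> g \<bullet> (q - y) \<le> 0"
    then have pos: "g \<bullet> (q - y) > 0" by simp
    have "(?\<rho> has_derivative (\<lambda>h. h \<bullet> g)) (at (y + 0 *\<^sub>R (q - y)))"
      using height_GDERIV[OF w] by (simp add: g_def gderiv_def)
    moreover have "((\<lambda>t. y + t *\<^sub>R (q - y)) has_derivative (\<lambda>h. h *\<^sub>R (q - y))) (at 0)"
      by (auto intro!: derivative_eq_intros)
    ultimately have "(?\<rho> \<circ> (\<lambda>t. y + t *\<^sub>R (q - y)) has_derivative (\<lambda>h. h \<bullet> g) \<circ> (\<lambda>h. h *\<^sub>R (q - y))) (at 0)"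
      by (intro diff_chain_at)
    then have "(?\<rho> \<circ> (\<lambda>t. y + t *\<^sub>R (q - y)) has_real_derivative g \<bullet> (q - y)) (at 0)"
      by (simp add: has_field_derivative_def o_def inner_commute mult.commute[of _ "g \<bullet> _"])
    from DERIV_pos_inc_right[OF this pos] obtain r where r: "r > 0"
      "\<And>h. h > 0 \<Longrightarrow> h < r \<Longrightarrow> ?\<rho> y < ?\<rho> (y + h *\<^sub>R (q - y))" by auto
    define h where "h = min r 1 / 2"
    have h: "0 < h" "h < r" "h < 1" using r(1) by (auto simp: h_def)
    have "(1 - h) *\<^sub>R y + h *\<^sub>R q \<in> cball p R"
      using convex_cball[of p R] y(2) q h unfolding convex_alt by auto
    moreover have "(1 - h) *\<^sub>R y + h *\<^sub>R q = y + h *\<^sub>R (q - y)" by (simp add: algebra_simps)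
    ultimately show False using r(2)[OF h(1,2)] \<rho> \<rho>y by fastforce
  qed
  \<comment> \<open>The point of the ball farthest in direction g. Testing with it gives equality in
    the Cauchy-Schwarz inequality for g and y - p.\<close>
  have "p + (R / norm g) *\<^sub>R g \<in> cball p R" using R gnz by (simp add: dist_norm)
  from first_order[OF this] have "g \<bullet> (p - y) + R / norm g * (g \<bullet> g) \<le> 0"
    by (simp add: inner_diff_right inner_add_right)
  moreover have "R / norm g * (g \<bullet> g) = R * norm g"
    using gnz by (simp add: dot_square_norm power2_eq_square)
  ultimately have "R * norm g \<le> g \<bullet> (y - p)" by (simp add: inner_diff_right)
  moreover have ny: "norm (y - p) = R" using y(2) by (simp add: dist_norm norm_minus_commute)
  moreover have "g \<bullet> (y - p) \<le> norm g * norm (y - p)" by (rule norm_cauchy_schwarz)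
  ultimately have "g \<bullet> (y - p) = norm g * norm (y - p)" by (simp add: mult.commute)
  then have "norm g *\<^sub>R (y - p) = norm (y - p) *\<^sub>R g" by (simp only: norm_cauchy_schwarz_eq)
  then have eq: "norm g *\<^sub>R (y - p) = R *\<^sub>R g" by (simp only: ny)
  have "y - p = (1 / norm g) *\<^sub>R (norm g *\<^sub>R (y - p))" using gnz by simp
  then have "(y - p) /\<^sub>R R = (1 / R) *\<^sub>R (1 / norm g) *\<^sub>R R *\<^sub>R g" unfolding eq by (simp add: divide_inverse)
  then show ?thesis using R by (simp add: g_def divide_inverse)
qed

end

section \<open>Consequences of coercivity and the contradiction between the two slopes\<close>

lemma coercive_bounded_sublevel:
  fixes \<phi> :: "'a::real_normed_vector \<Rightarrow> real"
  assumes "coercive \<phi>"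
  obtains B where "\<And>x. \<phi> x \<le> X \<Longrightarrow> norm x \<le> B"
proof -
  have "\<forall>\<^sub>F x in at_infinity. X < \<phi> x"
    using assms unfolding coercive_def filterlim_at_top_dense by blast
  then obtain B where "\<And>x. B \<le> norm x \<Longrightarrow> X < \<phi> x" unfolding eventually_at_infinity by blast
  then show thesis using that[of B] by (meson linorder_le_cases not_le)
qed

lemma coercive_attains_min:
  fixes \<phi> :: "'a::euclidean_space \<Rightarrow> real"
  assumes "coercive \<phi>" "continuous_on UNIV \<phi>"
  obtains z where "\<And>x. \<phi> z \<le> \<phi> x"
proof -
  obtain B where B: "\<And>x. \<phi> x \<le> \<phi> 0 \<Longrightarrow> norm x \<le> B" using coercive_bounded_sublevel[OF assms(1)] by blast
  have ne: "cball 0 B \<noteq> ({} :: 'a set)" using B[of 0] by simp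
  obtain z where z: "z \<in> cball 0 B" "\<And>x. x \<in> cball 0 B \<Longrightarrow> \<phi> z \<le> \<phi> x"
    using continuous_attains_inf[OF compact_cball ne continuous_on_subset[OF assms(2) subset_UNIV]] by blast
  have "\<phi> z \<le> \<phi> x" for x
    using z(2)[of x] z(2)[of 0] B[of x] B[of 0] by (cases "\<phi> x \<le> \<phi> 0") auto
  then show thesis using that by blast
qed

theorem theorem1p3:
  fixes \<phi> :: "real ^ 'm \<Rightarrow> real"
    and W W' W'' :: "real \<Rightarrow> real"
  assumes "smooth_on UNIV \<phi>"
    and "coercive \<phi>"
    and "C2_half_line W W' W''"
    and "double_well W W' W''"
  shows "\<nexists>u c. overdetermined_solution (epigraph_domain \<phi>) W' c u"
proof
  assume "\<exists>u c. overdetermined_solution (epigraph_domain \<phi>) W' c u"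
  then obtain u c where sol: "overdetermined_solution (epigraph_domain \<phi>) W' c u" by blast
  then obtain G where G: "C1_closure_grad (epigraph_domain \<phi>) u G"
    and c: "\<forall>x\<in>frontier (epigraph_domain \<phi>). \<forall>\<nu>. outer_unit_normal (epigraph_domain \<phi>) x \<nu> \<longrightarrow> G x \<bullet> \<nu> = c"
    unfolding overdetermined_solution_def by (elim conjE exE) (rule that)
  have C1: "Ck_on 1 UNIV \<phi>" using assms(1) unfolding smooth_on_def by blast
  note \<phi>c = C1_continuous[OF C1]
  obtain z where z: "\<And>x. \<phi> z \<le> \<phi> x" using coercive_attains_min[OF assms(2) \<phi>c] by blast
  define e :: "(real ^ 'm) \<times> real" where "e = (0, 1)"
  interpret slab_solution W W' W'' "epigraph_domain \<phi>" u e "\<phi> z"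
  proof
    show "C2_half_line W W' W''" "double_well W W' W''" by fact+
    show "open (epigraph_domain \<phi>)" by (rule open_epigraph[OF \<phi>c])
    show "continuous_on (closure (epigraph_domain \<phi>)) u" using G by (simp add: C1_closure_grad_def)
    show "norm e = 1" by (simp add: e_def norm_prod_def)
    show "\<phi> z \<le> x \<bullet> e" if "x \<in> closure (epigraph_domain \<phi>)" for x
      using that z[of "fst x"] by (auto simp: closure_epigraph[OF \<phi>c] e_def inner_prod_def)
    show "bounded {x \<in> closure (epigraph_domain \<phi>). x \<bullet> e \<le> X}" for X
    proof -
      obtain B where B: "\<And>x. \<phi> x \<le> X \<Longrightarrow> norm x \<le> B" using coercive_bounded_sublevel[OF assms(2)] by blast
      have "{x \<in> closure (epigraph_domain \<phi>). x \<bullet> e \<le> X} \<subseteq> cball 0 B \<times> {\<phi> z..X}"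
        using B by (fastforce simp: closure_epigraph[OF \<phi>c] e_def inner_prod_def intro: order_trans[OF z])
      then show ?thesis by (rule bounded_subset[rotated]) (auto intro: bounded_Times)
    qed
  qed (use sol in \<open>simp_all add: overdetermined_solution_def\<close>)

  \<comment> \<open>A horizontal unit vector for the tangential factor; it exists because the base
    space has dimension at least 1, which is where n >= 2 enters.\<close>
  obtain b :: "real ^ 'm" where b: "b \<in> Basis" using nonempty_Basis by blast
  let ?y = "(z, \<phi> z)"
  have y: "?y \<in> frontier (epigraph_domain \<phi>)" by (simp add: frontier_epigraph[OF \<phi>c])
  have "G ?y \<bullet> e < sqrt (2 * W 0)"
  proof (rule slope_upper[OF G y, of 1 "(b, 0)"])
    show "?y + t *\<^sub>R e \<in> epigraph_domain \<phi>" if "t \<in> {0<..<1}" for t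
      using that by (simp add: e_def epigraph_domain_def)
  qed (use b in \<open>auto simp: e_def inner_prod_def norm_prod_def\<close>)
  \<comment> \<open>At the minimum point z the gradient of \<phi> vanishes, so the outer normal
    above z is - e.\<close>
  moreover have "G ?y \<bullet> e = - c"
  proof -
    obtain D where D: "(\<phi> has_derivative D) (at z)"
      using C1_differentiable[OF C1] unfolding differentiable_def by blast
    have "D = (\<lambda>v. 0)" by (rule differential_zero_maxmin[of z UNIV \<phi> D]) (use D z in auto)
    with D have "GDERIV \<phi> (fst ?y) :> 0" by (simp add: gderiv_def)
    from c[rule_format, OF y epigraph_normal[OF C1 y this]] show ?thesis
      by (simp add: e_def norm_prod_def inner_prod_def)
  qed
  ultimately have upper: "- c < sqrt (2 * W 0)" by simp

  \<comment> \<open>The touching ball and its contact point change with a, but the normal derivative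
    is the same constant c at every boundary point.\<close>
  have lower: "sqrt (2 * W 0 - a) \<le> - c" if a: "a > 0" for a
  proof -
    obtain R where R: "R > 0" "\<And>p y. ball p R \<subseteq> epigraph_domain \<phi> \<Longrightarrow> y \<in> frontier (epigraph_domain \<phi>) \<Longrightarrow>
        dist p y = R \<Longrightarrow> sqrt (2 * W 0 - a) \<le> G y \<bullet> ((p - y) /\<^sub>R R)"
      using slope_lower[OF G a] by blast
    obtain p y where py: "ball p R \<subseteq> epigraph_domain \<phi>" "y \<in> frontier (epigraph_domain \<phi>)" "dist p y = R"
      using touching_ball[OF \<phi>c R(1)] by blast
    obtain w where w: "GDERIV \<phi> (fst y) :> w" using gradient_exists[OF C1_differentiable[OF C1]] by blast
    have "G y \<bullet> ((y - p) /\<^sub>R R) = c"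
      using c[rule_format, OF py(2) epigraph_normal[OF C1 py(2) w]]
      by (simp only: touching_ball_normal[OF C1 py(1) R(1) py(2,3) w])
    then have "G y \<bullet> ((p - y) /\<^sub>R R) = - c" by (simp add: inner_diff_right algebra_simps)
    with R(2)[OF py] show ?thesis by simp
  qed
  have "((\<lambda>a. sqrt (2 * W 0 - a)) \<longlongrightarrow> sqrt (2 * W 0 - 0)) (at_right 0)"
    by (intro tendsto_intros)
  moreover have "\<forall>\<^sub>F a in at_right 0. sqrt (2 * W 0 - a) \<le> - c"
    unfolding eventually_at_right_field using lower by (intro exI[of _ 1]) auto
  ultimately have "sqrt (2 * W 0 - 0) \<le> - c" by (rule tendsto_upperbound) simp
  with upper show False by simp
qed

end
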